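(* Let $d\ge1$, $\mu\in\mathbb{R}^d$, $A$ a $d\times d$ symmetric positive definite matrix and $R$ a $d\times d$ reflection nonsingular $\mathcal{M}$-matrix. Fix a nonempty subset $J\subseteq\{1,\dots,d\}$. Suppose that for every $I$ with $J\subseteq I\subseteq\{1,\dots,d\}$ the process $\mathrm{SRBM}^{|I|}([R]_I,[\mu]_I,[A]_I)$ does not hit the corner. Then $\mathrm{SRBM}^d(R,\mu,A)$ does not hit the edge $S_J$.
   Context: For $I=\{i_1<\dots<i_m\}\subseteq\{1,\dots,d\}$: $[x]_I=(x_{i_1},\dots,x_{i_m})'$ and $[C]_I=(c_{i_ki_l})_{1\le k,l\le m}$ for a $d\times d$ matrix $C$. Let $S=\mathbb{R}^d_+$ and $S_I=\{x\in S: x_i=0\ \forall i\in I\}$. A $d\times d$ matrix $R$ is a reflection nonsingular $\mathcal{M}$-matrix if $r_{ii}=1$, $r_{ij}\le 0$ for $i\ne j$ and the spectral radius of $I_d-R$ is less than $1$. $\mathrm{SRBM}^d(R,\mu,A)$ started at $z\in S$: a continuous adapted $S$-valued process $Z=B+RL$, where $B$ is a Brownian motion with drift $\mu$, covariance $A$, $B(0)=z$, and $L=(L_1,\dots,L_d)'$ continuous adapted, each $L_k$ nondecreasing, $L_k(0)=0$, $\int_0^\infty Z_k\,dL_k=0$; for reflection nonsingular $\mathcal{M}$-matrices it exists and is pathwise unique for all $z$. It does not hit $S_I$ if $\mathbb{P}_z(\exists t>0:Z(t)\in S_I)=0$ for every $z\in S$; not hitting the corner means not hitting $S_{\{1,\dots,d\}}=\{0\}$.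 *)

theory Defs
  imports "HOL-Probability.Probability" "Jordan_Normal_Form.Spectral_Radius"
begin

text \<open>Conventions. Coordinates are indexed by natural numbers; the ambient index set
{1,...,d} of the paper is rendered as {0..<d}. Vectors are functions nat => real and
d x d matrices are functions nat => nat => real; only the entries with indices in the
relevant index set matter. For an index set I, the SRBM "on I" is the SRBM whose coordinates
are indexed by I; it is SRBM^{|I|}([R]_I,[mu]_I,[A]_I) up to the order-preserving
renumbering of I as {1,...,|I|}.\<close>

definition sym_pos_def_on :: "nat set \<Rightarrow> (nat \<Rightarrow> nat \<Rightarrow> real) \<Rightarrow> bool" where
  "sym_pos_def_on I A \<longleftrightarrow> (\<forall>i\<in>I. \<forall>j\<in>I. A i j = A j i) \<and>
     (\<forall>x::nat \<Rightarrow> real. (\<exists>i\<in>I. x i \<noteq> 0) \<longrightarrow> (\<Sum>i\<in>I. \<Sum>j\<in>I. x i * A i j * x j) > 0)"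

definition id_minus_mat :: "nat \<Rightarrow> (nat \<Rightarrow> nat \<Rightarrow> real) \<Rightarrow> complex mat" where
  "id_minus_mat d R = mat d d (\<lambda>(i,j). complex_of_real ((if i = j then 1 else 0) - R i j))"

definition reflection_nonsingular_M_matrix :: "nat \<Rightarrow> (nat \<Rightarrow> nat \<Rightarrow> real) \<Rightarrow> bool" where
  "reflection_nonsingular_M_matrix d R \<longleftrightarrow>
     (\<forall>i<d. R i i = 1) \<and> (\<forall>i<d. \<forall>j<d. i \<noteq> j \<longrightarrow> R i j \<le> 0) \<and>
     spectral_radius (id_minus_mat d R) < 1"

text \<open>Filtration on the probability space M (time parameter real, only t >= 0 used).\<close>
definition filtration_on :: "'w measure \<Rightarrow> (real \<Rightarrow> 'w measure) \<Rightarrow> bool" where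
  "filtration_on M F \<longleftrightarrow> filtration (space M) F \<and> (\<forall>t. sets (F t) \<subseteq> sets M)"

definition adapted_on :: "nat set \<Rightarrow> (real \<Rightarrow> 'w measure) \<Rightarrow> (real \<Rightarrow> 'w \<Rightarrow> nat \<Rightarrow> real) \<Rightarrow> bool" where
  "adapted_on I F X \<longleftrightarrow> (\<forall>t\<ge>0. \<forall>i\<in>I. (\<lambda>\<omega>. X t \<omega> i) \<in> borel_measurable (F t))"

definition continuous_paths_on :: "nat set \<Rightarrow> 'w measure \<Rightarrow> (real \<Rightarrow> 'w \<Rightarrow> nat \<Rightarrow> real) \<Rightarrow> bool" where
  "continuous_paths_on I M X \<longleftrightarrow> (\<forall>\<omega>\<in>space M. \<forall>i\<in>I. continuous_on {0..} (\<lambda>t. X t \<omega> i))"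

text \<open>Brownian motion (with respect to the filtration F) with coordinates indexed by I,
drift mu, covariance matrix A, started at z: continuous adapted paths, B(0) = z,
increments B(t)-B(s) (s < t) independent of F_s and Gaussian with mean (t-s) mu and
covariance (t-s) A (Gaussianity expressed through all linear functionals, Cramer--Wold).\<close>
definition brownian_motion_on ::
  "nat set \<Rightarrow> 'w measure \<Rightarrow> (real \<Rightarrow> 'w measure) \<Rightarrow> (nat \<Rightarrow> real) \<Rightarrow> (nat \<Rightarrow> nat \<Rightarrow> real)
   \<Rightarrow> (nat \<Rightarrow> real) \<Rightarrow> (real \<Rightarrow> 'w \<Rightarrow> nat \<Rightarrow> real) \<Rightarrow> bool" where
  "brownian_motion_on I M F \<mu> A z B \<longleftrightarrow>
     adapted_on I F B \<and> continuous_paths_on I M B \<and>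
     (\<forall>\<omega>\<in>space M. \<forall>i\<in>I. B 0 \<omega> i = z i) \<and>
     (\<forall>s t. 0 \<le> s \<longrightarrow> s < t \<longrightarrow>
        (\<forall>a\<in>sets (F s). \<forall>E\<in>sets (PiM I (\<lambda>_. borel)).
           measure M (a \<inter> {\<omega>\<in>space M. restrict (\<lambda>i. B t \<omega> i - B s \<omega> i) I \<in> E}) =
           measure M a * measure M {\<omega>\<in>space M. restrict (\<lambda>i. B t \<omega> i - B s \<omega> i) I \<in> E}) \<and>
        (\<forall>u::nat \<Rightarrow> real. (\<exists>i\<in>I. u i \<noteq> 0) \<longrightarrow>
           distributed M lborel (\<lambda>\<omega>. \<Sum>i\<in>I. u i * (B t \<omega> i - B s \<omega> i))
             (normal_density ((t - s) * (\<Sum>i\<in>I. u i * \<mu> i))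
                (sqrt ((t - s) * (\<Sum>i\<in>I. \<Sum>j\<in>I. u i * A i j * u j))))))"

text \<open>Z = B + R L is an SRBM on I (data R, mu, A) started at z, on the filtered probability
space (M, F). The complementarity condition int_0^infty Z_k dL_k = 0 is the Lebesgue--Stieltjes
integral with respect to the measure induced by the continuous nondecreasing t |-> L_k(max 0 t)
(which has no mass on (-infinity,0]).\<close>
definition srbm_on ::
  "nat set \<Rightarrow> (nat \<Rightarrow> nat \<Rightarrow> real) \<Rightarrow> (nat \<Rightarrow> real) \<Rightarrow> (nat \<Rightarrow> nat \<Rightarrow> real) \<Rightarrow> (nat \<Rightarrow> real)
   \<Rightarrow> 'w measure \<Rightarrow> (real \<Rightarrow> 'w measure)
   \<Rightarrow> (real \<Rightarrow> 'w \<Rightarrow> nat \<Rightarrow> real) \<Rightarrow> (real \<Rightarrow> 'w \<Rightarrow> nat \<Rightarrow> real) \<Rightarrow> (real \<Rightarrow> 'w \<Rightarrow> nat \<Rightarrow> real) \<Rightarrow> bool" where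
  "srbm_on I R \<mu> A z M F Z B L \<longleftrightarrow>
     prob_space M \<and> filtration_on M F \<and>
     brownian_motion_on I M F \<mu> A z B \<and>
     adapted_on I F Z \<and> continuous_paths_on I M Z \<and>
     adapted_on I F L \<and> continuous_paths_on I M L \<and>
     (\<forall>\<omega>\<in>space M. \<forall>k\<in>I. L 0 \<omega> k = 0 \<and> mono_on {0..} (\<lambda>t. L t \<omega> k)) \<and>
     (\<forall>\<omega>\<in>space M. \<forall>t\<ge>0. \<forall>i\<in>I. Z t \<omega> i = B t \<omega> i + (\<Sum>j\<in>I. R i j * L t \<omega> j)) \<and>
     (\<forall>\<omega>\<in>space M. \<forall>t\<ge>0. \<forall>i\<in>I. Z t \<omega> i \<ge> 0) \<and>
     (\<forall>\<omega>\<in>space M. \<forall>k\<in>I.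
        (\<integral>\<^sup>+ t. ennreal (Z t \<omega> k) \<partial>(interval_measure (\<lambda>t. L (max 0 t) \<omega> k))) = 0)"

definition srbm_not_hit ::
  "'w itself \<Rightarrow> nat set \<Rightarrow> (nat \<Rightarrow> nat \<Rightarrow> real) \<Rightarrow> (nat \<Rightarrow> real) \<Rightarrow> (nat \<Rightarrow> nat \<Rightarrow> real) \<Rightarrow> nat set \<Rightarrow> bool" where
  "srbm_not_hit _ I R \<mu> A J \<longleftrightarrow>
     (\<forall>z. (\<forall>i\<in>I. z i \<ge> 0) \<longrightarrow>
       (\<forall>(M::'w measure) F Z B L. srbm_on I R \<mu> A z M F Z B L \<longrightarrow>
          (AE \<omega> in M. \<forall>t>0. \<not> (\<forall>j\<in>J. Z t \<omega> j = 0))))"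

end

theory Submission
  imports Defs
begin

text \<open>If \<open>Z\<close> hits the edge at time \<open>t\<close>, let \<open>I\<close> be the set of all coordinates vanishing at \<open>t\<close>.
  On some interval \<open>[q, r]\<close> around \<open>t\<close> with rational endpoints the other coordinates stay positive, so
  their regulators are constant there and \<open>([Z]\<^sub>I, [L]\<^sub>I - [L]\<^sub>I(q))\<close> solves the Skorokhod problem for
  \<open>[R]\<^sub>I\<close> driven by \<open>[Z(q) + B - B(q)]\<^sub>I\<close>. This problem is uniquely solvable, because for suitable
  weights \<open>I - R\<close> is a contraction; hence \<open>[Z]\<^sub>I\<close> coincides on \<open>[q, r]\<close> with an SRBM on \<open>I\<close>
  started at \<open>[Z(q)]\<^sub>I\<close>. Conditionally on \<open>F(q)\<close> the latter does not reach the corner.\<close>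

text \<open>Collecting every coordinate that vanishes at \<open>t\<close>, rather than
  \<open>J\<close> alone, is what keeps the others strictly positive near \<open>t\<close>. This set
  varies with the path and the hitting time, so the hypothesis is needed for every \<open>I\<close>
  above \<open>J\<close>, and the exceptional events have to be indexed by the countably many
  triples of \<open>I\<close> and rational \<open>q\<close>, \<open>r\<close>. The hypothesis speaks
  only of actual SRBMs with a fixed starting point on spaces over \<open>'w\<close>. The solution
  map is therefore constructed pathwise by Picard iteration and run on the given space; its
  measurability yields adaptedness and, for the random start, joint measurability in start and
  noise. The weights are a truncated Neumann series, the sum over \<open>k < N\<close> of the
  vectors P^k 1 with P = I - R; nonnegativity of the off-diagonal entries of P makes them suit all
  principal submatrices at once. The definition of Brownian motion makes one increment at a time
  independent of the past. Freezing \<open>Z q\<close> requires independence of the whole future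
  path, which is obtained by induction over finite sets of times.\<close>

section \<open>The running maximum\<close>

text \<open>The regulator of one-dimensional Skorokhod reflection: for continuous \<open>f\<close>
  it is the smallest nonnegative nondecreasing function above \<open>f\<close>. The positive part
  keeps it at 0 as long as \<open>f\<close> has not become positive.\<close>

definition runmax :: "(real \<Rightarrow> real) \<Rightarrow> real \<Rightarrow> real" where
  "runmax f t = (SUP s\<in>{0..t}. max 0 (f s))"

lemma runmax_bdd:
  fixes f :: "real \<Rightarrow> real"
  assumes "continuous_on {0..t} f"
  shows "bdd_above ((\<lambda>s. max 0 (f s)) ` {0..t::real})"
proof -
  have "compact ((\<lambda>s. max 0 (f s)) ` {0..t})"
    by (intro compact_continuous_image compact_Icc continuous_on_max[OF continuous_on_const assms])
  then show ?thesis by (rule compact_imp_bounded[THEN bounded_imp_bdd_above])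
qed

lemma runmax_upper:
  assumes "continuous_on {0..t} f" "0 \<le> s" "s \<le> t"
  shows "f s \<le> runmax f t" "0 \<le> runmax f t"
proof -
  have "max 0 (f s) \<le> runmax f t"
    unfolding runmax_def by (rule cSUP_upper[OF _ runmax_bdd[OF assms(1)]]) (use assms in auto)
  then show "f s \<le> runmax f t" "0 \<le> runmax f t" by auto
qed

lemma runmax_least:
  assumes "0 \<le> t" "0 \<le> c" "\<And>s. 0 \<le> s \<Longrightarrow> s \<le> t \<Longrightarrow> f s \<le> c"
  shows "runmax f t \<le> c"
  unfolding runmax_def by (rule cSUP_least) (use assms in auto)

lemma runmax_le_iff:
  assumes "continuous_on {0..t} f" "0 \<le> t"
  shows "runmax f t \<le> c \<longleftrightarrow> 0 \<le> c \<and> (\<forall>s\<in>{0..t}. f s \<le> c)"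
  using runmax_upper[OF assms(1)] runmax_least[of t c f] assms(2) by (meson atLeastAtMost_iff order_refl order_trans)

lemma runmax_mono:
  assumes "continuous_on {0..b} f" "0 \<le> a" "a \<le> b"
  shows "runmax f a \<le> runmax f b"
  by (rule runmax_least) (use runmax_upper[OF assms(1)] assms in auto)

lemma runmax_zero: "runmax f 0 = max 0 (f 0)"
  by (simp add: runmax_def)

text \<open>The Lipschitz constant 1 matters: taking running maxima costs nothing, so the
  contraction factor of the matrix survives intact.\<close>

lemma runmax_diff:
  assumes "continuous_on {0..t} f" "continuous_on {0..t} g" "0 \<le> t"
    and "\<And>s. 0 \<le> s \<Longrightarrow> s \<le> t \<Longrightarrow> \<bar>f s - g s\<bar> \<le> c"
  shows "\<bar>runmax f t - runmax g t\<bar> \<le> c"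
proof -
  have c: "0 \<le> c" using assms(4)[of 0] assms(3) by linarith
  have *: "runmax f' t \<le> runmax g' t + c"
    if "continuous_on {0..t} g'" "\<And>s. 0 \<le> s \<Longrightarrow> s \<le> t \<Longrightarrow> \<bar>f' s - g' s\<bar> \<le> c" for f' g'
  proof (rule runmax_least)
    show "0 \<le> runmax g' t + c" using runmax_upper(2)[OF that(1), of 0] c assms(3) by linarith
    fix s assume "0 \<le> s" "s \<le> t"
    then show "f' s \<le> runmax g' t + c" using runmax_upper(1)[OF that(1), of s] that(2)[of s] by linarith
  qed (rule assms)
  show ?thesis using *[of g f] *[of f g] assms by (simp add: abs_minus_commute)
qed

lemma runmax_continuous:
  assumes f: "continuous_on {0..T} f"
  shows "continuous_on {0..T} (runmax f)"
proof (rule uniformly_continuous_imp_continuous)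
  have uf: "uniformly_continuous_on {0..T} f" by (rule compact_uniformly_continuous[OF f]) simp
  show "uniformly_continuous_on {0..T} (runmax f)"
    unfolding uniformly_continuous_on_def
  proof safe
    fix e :: real assume "e > 0"
    then obtain \<delta> where d: "\<delta> > 0"
      "\<And>x x'. x \<in> {0..T} \<Longrightarrow> x' \<in> {0..T} \<Longrightarrow> dist x' x < \<delta> \<Longrightarrow> dist (f x') (f x) < e/2"
      using uf[unfolded uniformly_continuous_on_def, rule_format, of "e/2"] by auto
    have *: "runmax f b \<le> runmax f a + e/2" if "0 \<le> a" "a \<le> b" "b \<le> T" "b - a < \<delta>" for a b
    proof (rule runmax_least)
      have fa: "continuous_on {0..a} f" by (rule continuous_on_subset[OF f]) (use that in auto)
      show "0 \<le> runmax f a + e/2" using runmax_upper(2)[OF fa, of 0] that \<open>e > 0\<close> by auto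
      fix s assume "0 \<le> s" "s \<le> b"
      \<comment> \<open>The comparison point \<open>min s a\<close> is \<open>s\<close> itself up to
        \<open>a\<close> and equals \<open>a\<close> afterwards, at distance at most
        \<open>b - a\<close>.\<close>
      then have "dist (f s) (f (min s a)) < e/2" by (intro d(2)) (use that d(1) in \<open>auto simp: dist_real_def\<close>)
      then have "f s \<le> f (min s a) + e/2" unfolding dist_real_def by linarith
      then show "f s \<le> runmax f a + e/2"
        using runmax_upper(1)[OF fa, of "min s a"] \<open>0 \<le> s\<close> that by auto
    qed (use that in auto)
    have m: "runmax f a \<le> runmax f b" if "0 \<le> a" "a \<le> b" "b \<le> T" for a b
      by (rule runmax_mono[OF continuous_on_subset[OF f]]) (use that in auto)
    show "\<exists>d>0. \<forall>x\<in>{0..T}. \<forall>x'\<in>{0..T}. dist x' x < d \<longrightarrow> dist (runmax f x') (runmax f x) < e"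
    proof (intro exI[of _ \<delta>] conjI d ballI impI)
      fix x x' assume a: "x \<in> {0..T}" "x' \<in> {0..T}" "dist x' x < \<delta>"
      show "dist (runmax f x') (runmax f x) < e"
      proof (cases "x \<le> x'")
        case True then show ?thesis using *[of x x'] m[of x x'] a \<open>e > 0\<close> by (auto simp: dist_real_def)
      next
        case False then show ?thesis using *[of x' x] m[of x' x] a \<open>e > 0\<close> by (auto simp: dist_real_def)
      qed
    qed
  qed
qed

lemma continuous_on_atLeastI:
  fixes f :: "real \<Rightarrow> real"
  assumes "\<And>T. T \<ge> 0 \<Longrightarrow> continuous_on {0..T} f"
  shows "continuous_on {0..} f"
  unfolding continuous_on_eq_continuous_within
proof
  fix x :: real assume x: "x \<in> {0..}"
  then have "continuous (at x within {0..x+1}) f"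
    using assms[of "x+1"] by (auto simp: continuous_on_eq_continuous_within)
  moreover have "at x within {0..x+1} = at x within {0..}"
    by (rule at_within_nhd[of _ "{..<x+1}"]) auto
  ultimately show "continuous (at x within {0..}) f" by simp
qed

section \<open>Measurability of path functionals\<close>

text \<open>Continuity reduces a sublevel set to conditions at countably many dense times. Only
  times up to \<open>t\<close> enter, so that \<open>N = F t\<close> is a possible choice and
  adaptedness follows.\<close>

lemma runmax_measurable:
  assumes m: "\<And>s. 0 \<le> s \<Longrightarrow> s \<le> t \<Longrightarrow> (\<lambda>\<omega>. X s \<omega>) \<in> borel_measurable N"
    and c: "\<And>\<omega>. \<omega> \<in> space N \<Longrightarrow> continuous_on {0..t} (\<lambda>s. X s \<omega>)"
    and t: "0 \<le> t"
  shows "(\<lambda>\<omega>. runmax (\<lambda>s. X s \<omega>) t) \<in> borel_measurable N"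
proof (rule borel_measurable_iff_le[THEN iffD2], rule allI)
  fix a :: real
  obtain D where D: "countable D" "D \<subseteq> {0..t}" "{0..t} \<subseteq> closure D"
    using separable[of "{0..t}"] by blast
  have cl: "closure D = {0..t}" using D closure_minimal[of D "{0..t}"] by auto
  have "{\<omega> \<in> space N. runmax (\<lambda>s. X s \<omega>) t \<le> a} = {\<omega> \<in> space N. 0 \<le> a \<and> (\<forall>s\<in>D. X s \<omega> \<le> a)}"
  proof (rule Collect_cong, rule conj_cong[OF refl])
    fix \<omega> assume w: "\<omega> \<in> space N"
    have "(\<forall>s\<in>D. X s \<omega> \<le> a) \<longleftrightarrow> (\<forall>s\<in>{0..t}. X s \<omega> \<le> a)"
      using continuous_le_on_closure[of D "\<lambda>s. X s \<omega>" _ a] c[OF w] cl D(2) by auto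
    then show "runmax (\<lambda>s. X s \<omega>) t \<le> a \<longleftrightarrow> 0 \<le> a \<and> (\<forall>s\<in>D. X s \<omega> \<le> a)"
      using runmax_le_iff[OF c[OF w] t] by simp
  qed
  also have "\<dots> \<in> sets N"
  proof -
    have "Measurable.pred N (\<lambda>\<omega>. X s \<omega> \<le> a)" if "s \<in> D" for s
      using m[of s] D(2) that by (auto intro!: borel_measurable_le)
    then have "Measurable.pred N (\<lambda>\<omega>. \<forall>s\<in>D. X s \<omega> \<le> a)"
      unfolding pred_def by (intro sets.sets_Collect_countable_All' D(1))
    then show ?thesis by (cases "0 \<le> a") (auto simp: pred_def)
  qed
  finally show "{\<omega> \<in> space N. runmax (\<lambda>s. X s \<omega>) t \<le> a} \<in> sets N" .
qed

text \<open>The open half-line of times is exhausted by compact intervals. On each of them the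
  minimum of the absolute value is attained, so a zero exists exactly when the values on a countable
  dense set come arbitrarily close to 0.\<close>

lemma hits_zero_measurable:
  fixes X :: "real \<Rightarrow> 'a \<Rightarrow> real"
  assumes m: "\<And>s. 0 \<le> s \<Longrightarrow> (\<lambda>\<omega>. X s \<omega>) \<in> borel_measurable N"
    and c: "\<And>\<omega>. \<omega> \<in> space N \<Longrightarrow> continuous_on {0..} (\<lambda>s. X s \<omega>)"
  shows "{\<omega> \<in> space N. \<exists>t>0. X t \<omega> = 0} \<in> sets N"
proof -
  define H where "H n k = {\<omega> \<in> space N. \<exists>t\<in>{inverse (real (Suc n))..real k}. X t \<omega> = 0}" for n k
  have H: "H n k \<in> sets N" for n k
  proof (cases "inverse (real (Suc n)) \<le> real k")
    case False then show ?thesis by (simp add: H_def)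
  next
    case True
    let ?I = "{inverse (real (Suc n))..real k}"
    have pos: "s \<in> ?I \<Longrightarrow> 0 \<le> s" for s
      by (meson atLeastAtMost_iff inverse_nonnegative_iff_nonnegative of_nat_0_le_iff order_trans)
    obtain D where D: "countable D" "D \<subseteq> ?I" "?I \<subseteq> closure D"
      using separable[of ?I] by blast
    have cl: "closure D = ?I" using D closure_minimal[of D ?I] by auto
    have "H n k = {\<omega> \<in> space N. \<forall>j::nat. \<exists>s\<in>D. \<bar>X s \<omega>\<bar> < inverse (real (Suc j))}"
      unfolding H_def
    proof (rule Collect_cong, rule conj_cong[OF refl], rule iffI)
      fix \<omega> assume w: "\<omega> \<in> space N"
      have cI: "continuous_on ?I (\<lambda>s. X s \<omega>)"
        by (rule continuous_on_subset[OF c[OF w]]) (use pos in auto)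
      show "\<forall>j::nat. \<exists>s\<in>D. \<bar>X s \<omega>\<bar> < inverse (real (Suc j))"
        if ex: "\<exists>t\<in>?I. X t \<omega> = 0"
      proof (rule ccontr)
        assume "\<not> ?thesis"
        then obtain j where j: "\<And>s. s \<in> D \<Longrightarrow> - \<bar>X s \<omega>\<bar> \<le> - inverse (real (Suc j))"
          by (auto simp: not_less)
        obtain t where t: "t \<in> ?I" "X t \<omega> = 0" using ex by blast
        have "- \<bar>X t \<omega>\<bar> \<le> - inverse (real (Suc j))"
          by (rule continuous_le_on_closure[of D "\<lambda>s. - \<bar>X s \<omega>\<bar>"])
            (use cl cI t j in \<open>auto intro!: continuous_intros\<close>)
        then show False using t by simp
      qed
      show "\<exists>t\<in>?I. X t \<omega> = 0"
        if al: "\<forall>j::nat. \<exists>s\<in>D. \<bar>X s \<omega>\<bar> < inverse (real (Suc j))"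
      proof -
        have "continuous_on ?I (\<lambda>s. \<bar>X s \<omega>\<bar>)" by (intro continuous_intros cI)
        then obtain t where t: "t \<in> ?I" "\<And>s. s \<in> ?I \<Longrightarrow> \<bar>X t \<omega>\<bar> \<le> \<bar>X s \<omega>\<bar>"
          using continuous_attains_inf[of ?I "\<lambda>s. \<bar>X s \<omega>\<bar>"] True by auto
        have "X t \<omega> = 0"
        proof (rule ccontr)
          assume "X t \<omega> \<noteq> 0"
          then obtain j where "inverse (real (Suc j)) < \<bar>X t \<omega>\<bar>"
            using reals_Archimedean[of "\<bar>X t \<omega>\<bar>"] by auto
          moreover obtain s where "s \<in> D" "\<bar>X s \<omega>\<bar> < inverse (real (Suc j))" using al by blast
          ultimately show False using t(2)[of s] D(2) by auto
        qed
        then show ?thesis using t by blast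
      qed
    qed
    also have "\<dots> \<in> sets N"
    proof -
      have "{\<omega> \<in> space N. \<bar>X s \<omega>\<bar> < inverse (real (Suc j))} \<in> sets N" if "s \<in> D" for s and j :: nat
      proof -
        have [measurable]: "X s \<in> borel_measurable N" using m[of s] D(2) pos that by auto
        show ?thesis by measurable
      qed
      then show ?thesis
        by (intro sets.sets_Collect_countable_All sets.sets_Collect_countable_Ex' D(1))
    qed
    finally show ?thesis .
  qed
  have "{\<omega> \<in> space N. \<exists>t>0. X t \<omega> = 0} = (\<Union>n. \<Union>k. H n k)"
  proof safe
    fix \<omega> t assume w: "\<omega> \<in> space N" and t: "(0::real) < t" "X t \<omega> = 0"
    obtain n where "inverse (real (Suc n)) < t" using reals_Archimedean[OF t(1)] by blast
    moreover obtain k where "t \<le> real k" using real_arch_simple by blast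
    ultimately have "\<omega> \<in> H n k" using w t unfolding H_def by (auto intro!: bexI[of _ t])
    then show "\<omega> \<in> (\<Union>n. \<Union>k. H n k)" by blast
  next
    fix \<omega> n k assume "\<omega> \<in> H n k"
    then obtain t where t: "\<omega> \<in> space N" "inverse (real (Suc n)) \<le> t" "X t \<omega> = 0"
      by (auto simp: H_def)
    show "\<omega> \<in> space N" by (rule t)
    have "0 < inverse (real (Suc n))" by simp
    then have "0 < t" using t(2) by (rule less_le_trans)
    then show "\<exists>t>0. X t \<omega> = 0" using t(3) by blast
  qed
  also have "\<dots> \<in> sets N" using H by auto
  finally show ?thesis .
qed

section \<open>The one-dimensional reflection problem\<close>

text \<open>If \<open>l t\<close> exceeded \<open>runmax g t\<close>, then \<open>l\<close> would
  take the midpoint of the two values at some time \<open>s\<close>; from \<open>s\<close> on it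
  lies strictly above \<open>g\<close>, so flatness freezes it below \<open>l t\<close>. The other
  inequality needs only monotonicity and \<open>g \<le> l\<close>.\<close>

lemma reflection_formula:
  fixes l g :: "real \<Rightarrow> real"
  assumes cl: "continuous_on {0..T} l" and cg: "continuous_on {0..T} g"
    and l0: "l 0 = 0" and mono: "mono_on {0..T} l"
    and nn: "\<And>s. 0 \<le> s \<Longrightarrow> s \<le> T \<Longrightarrow> g s \<le> l s"
    and flat: "\<And>a b. 0 \<le> a \<Longrightarrow> a \<le> b \<Longrightarrow> b \<le> T \<Longrightarrow> (\<And>s. a \<le> s \<Longrightarrow> s \<le> b \<Longrightarrow> g s < l s) \<Longrightarrow> l a = l b"
    and t: "0 \<le> t" "t \<le> T"
  shows "l t = runmax g t"
proof (rule antisym)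
  have cgt: "continuous_on {0..t} g" by (rule continuous_on_subset[OF cg]) (use t in auto)
  have mn: "l a \<le> l b" if "0 \<le> a" "a \<le> b" "b \<le> T" for a b
    using mono_onD[OF mono, of a b] that by auto
  show "runmax g t \<le> l t"
  proof (rule runmax_least)
    show "0 \<le> l t" using mn[of 0 t] l0 t by simp
    show "g s \<le> l t" if "0 \<le> s" "s \<le> t" for s using nn[of s] mn[of s t] that t by linarith
  qed (rule t)
  show "l t \<le> runmax g t"
  proof (rule ccontr)
    assume "\<not> ?thesis"
    then have less: "runmax g t < l t" by simp
    have pos: "0 \<le> runmax g t" using runmax_upper(2)[OF cgt, of 0] t by simp
    have "\<exists>s\<ge>0. s \<le> t \<and> l s = (runmax g t + l t) / 2"
      by (rule IVT') (use less pos l0 t in \<open>auto intro: continuous_on_subset[OF cl]\<close>)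
    then obtain s where s: "0 \<le> s" "s \<le> t" "l s = (runmax g t + l t) / 2" by blast
    have "l s = l t"
    proof (rule flat)
      fix r assume r: "s \<le> r" "r \<le> t"
      have "g r \<le> runmax g t" using runmax_upper(1)[OF cgt, of r] r s by auto
      also have "\<dots> < l s" using s less by simp
      also have "\<dots> \<le> l r" using mn[of s r] r s t by auto
      finally show "g r < l r" .
    qed (use s t in auto)
    then show False using s less by simp
  qed
qed

text \<open>Consider a maximum point \<open>s\<close> of \<open>g\<close> on \<open>{0..b}\<close>.
  If \<open>s \<le> a\<close> or \<open>g s \<le> 0\<close>, the final value is already reached at
  \<open>a\<close>; otherwise \<open>g s\<close> would equal the running maximum at
  \<open>s > a\<close>, which strictness excludes.\<close>

lemma runmax_flat:
  assumes cg: "continuous_on {0..b} g" and ab: "0 \<le> a" "a \<le> b"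
    and less: "\<And>s. a \<le> s \<Longrightarrow> s \<le> b \<Longrightarrow> g s < runmax g s"
  shows "runmax g a = runmax g b"
proof (rule antisym)
  have mn: "runmax g s \<le> runmax g b" if "0 \<le> s" "s \<le> b" for s
    by (rule runmax_mono[OF cg]) (use that in auto)
  then show "runmax g a \<le> runmax g b" using ab by simp
  have cga: "continuous_on {0..a} g" by (rule continuous_on_subset[OF cg]) (use ab in auto)
  have pos: "0 \<le> runmax g a" using runmax_upper(2)[OF cga, of 0] ab by simp
  obtain s where s: "s \<in> {0..b}" "\<And>r. r \<in> {0..b} \<Longrightarrow> g r \<le> g s"
    using continuous_attains_sup[of "{0..b}" g] cg ab by auto
  show "runmax g b \<le> runmax g a"
  proof (cases "s \<le> a")
    case True
    have "g s \<le> runmax g a" using runmax_upper(1)[OF cga, of s] s True by auto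
    then show ?thesis by (intro runmax_least) (use pos s(2) ab in force)+
  next
    case False
    show ?thesis
    proof (cases "g s \<le> 0")
      case True
      then show ?thesis by (intro runmax_least) (use pos s(2) ab in force)+
    next
      case g: False
      have "runmax g b \<le> g s" by (intro runmax_least) (use g s(2) ab in force)+
      also have "\<dots> < runmax g s" using less[of s] s False by auto
      also have "\<dots> \<le> runmax g b" using mn[of s] s by auto
      finally show ?thesis by simp
    qed
  qed
qed

text \<open>The two conditions under which \<open>interval_measure\<close> assigns to
  \<open>{a<..b}\<close> the increment of the function, here \<open>l\<close> frozen at
  \<open>l 0\<close> on the negative axis.\<close>

lemma regulator_extension:
  fixes l :: "real \<Rightarrow> real"
  assumes "continuous_on {0..} l" "mono_on {0..} l"
  shows "x \<le> y \<Longrightarrow> l (max 0 x) \<le> l (max 0 y)"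
    and "continuous (at_right a) (\<lambda>t. l (max 0 t))"
proof -
  show "x \<le> y \<Longrightarrow> l (max 0 x) \<le> l (max 0 y)"
    using mono_onD[OF assms(2), of "max 0 x" "max 0 y"] by auto
  have "continuous_on UNIV (\<lambda>t. l (max 0 t))"
    by (rule continuous_on_compose2[OF assms(1)]) (auto intro!: continuous_intros)
  then show "continuous (at_right a) (\<lambda>t. l (max 0 t))"
    by (metis UNIV_I continuous_on_eq_continuous_within continuous_within_subset subset_UNIV)
qed

text \<open>Complementarity is used from here on only in the form of flatness: \<open>l\<close> is constant
  on every interval on which \<open>z\<close> is positive.\<close>

lemma flat_of_complementarity:
  fixes l z :: "real \<Rightarrow> real"
  assumes l: "continuous_on {0..} l" "mono_on {0..} l" and z: "continuous_on {0..} z"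
    and int: "(\<integral>\<^sup>+ t. ennreal (z t) \<partial>interval_measure (\<lambda>t. l (max 0 t))) = 0"
    and ab: "0 \<le> a" "a \<le> b" and pos: "\<And>s. a \<le> s \<Longrightarrow> s \<le> b \<Longrightarrow> 0 < z s"
  shows "l a = l b"
proof -
  let ?M = "interval_measure (\<lambda>t. l (max 0 t))"
  have "continuous_on {a..b} z" by (rule continuous_on_subset[OF z]) (use ab in auto)
  then obtain x where x: "x \<in> {a..b}" "\<And>s. s \<in> {a..b} \<Longrightarrow> z x \<le> z s"
    using continuous_attains_inf[of "{a..b}" z] ab by auto
  have zx: "0 < z x" using pos x by auto
  have "(\<integral>\<^sup>+ t. ennreal (z x) * indicator {a<..b} t \<partial>?M) \<le> (\<integral>\<^sup>+ t. ennreal (z t) \<partial>?M)"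
    by (intro nn_integral_mono) (auto simp: indicator_def intro!: ennreal_leI x(2))
  then have "ennreal (z x) * emeasure ?M {a<..b} = 0"
    using int by (simp add: nn_integral_cmult_indicator)
  then have "emeasure ?M {a<..b} = 0" using zx by simp
  moreover have "emeasure ?M {a<..b} = ennreal (l (max 0 b) - l (max 0 a))"
    by (rule emeasure_interval_measure_Ioc) (use ab regulator_extension[OF l] in auto)
  ultimately have "l b \<le> l a" using ab by (simp add: ennreal_eq_0_iff)
  moreover have "l a \<le> l b" using mono_onD[OF l(2), of a b] ab by auto
  ultimately show ?thesis by simp
qed

text \<open>Each positive time at which \<open>z\<close> is positive lies in one of countably many
  rational intervals on which \<open>z\<close> is positive, and flatness makes these null. The times
  up to 0 carry no mass because the integrator is constant there.\<close>

lemma complementarity_of_flat: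
  fixes l z :: "real \<Rightarrow> real"
  assumes l: "continuous_on {0..} l" "mono_on {0..} l" and z: "continuous_on {0..} z"
    and flat: "\<And>a b. 0 \<le> a \<Longrightarrow> a \<le> b \<Longrightarrow> (\<And>s. a \<le> s \<Longrightarrow> s \<le> b \<Longrightarrow> 0 < z s) \<Longrightarrow> l a = l b"
  shows "(\<integral>\<^sup>+ t. ennreal (z t) \<partial>interval_measure (\<lambda>t. l (max 0 t))) = 0"
proof -
  let ?M = "interval_measure (\<lambda>t. l (max 0 t))"
  have Ioc: "a \<le> b \<Longrightarrow> emeasure ?M {a<..b} = ennreal (l (max 0 b) - l (max 0 a))" for a b
    by (rule emeasure_interval_measure_Ioc) (use regulator_extension[OF l] in auto)
  define Q where "Q = {(a, b). a \<in> \<rat> \<and> b \<in> \<rat> \<and> 0 \<le> a \<and> a \<le> b \<and> (\<forall>s\<in>{a..b}. 0 < z s)}"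
  have Q: "countable Q"
    by (rule countable_subset[of _ "\<rat> \<times> \<rat>"]) (auto simp: Q_def countable_rat)
  define N where "N = (\<Union>n::nat. {-real n<..0}) \<union> (\<Union>(a,b)\<in>Q. {a<..b})"
  have 1: "(\<Union>n::nat. {-real n<..0}) \<in> null_sets ?M"
    by (rule null_sets_UN) (auto simp: null_sets_def Ioc)
  have 2: "(\<Union>p\<in>Q. case p of (a,b) \<Rightarrow> {a<..b}) \<in> null_sets ?M"
  proof (rule null_sets_UN'[OF Q])
    fix p assume "p \<in> Q"
    then obtain a b where "p = (a,b)" "0 \<le> a" "a \<le> b" "\<And>s. a \<le> s \<Longrightarrow> s \<le> b \<Longrightarrow> 0 < z s"
      by (auto simp: Q_def)
    then show "(case p of (a,b) \<Rightarrow> {a<..b}) \<in> null_sets ?M"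
      using flat[of a b] by (auto simp: null_sets_def Ioc)
  qed
  have N: "N \<in> null_sets ?M" unfolding N_def using 1 2 by (rule null_sets.Un)
  have "AE t in ?M. ennreal (z t) = 0"
  proof (rule AE_I'[OF N], safe)
    fix t assume t: "ennreal (z t) \<noteq> 0"
    then have zt: "0 < z t" by (simp add: ennreal_eq_0_iff)
    show "t \<in> N"
    proof (cases "t \<le> 0")
      case True
      obtain n where "- t < real n" using reals_Archimedean2 by blast
      then show ?thesis using True by (auto simp: N_def intro!: exI[of _ n])
    next
      case False
      have "continuous (at t within {0..}) z" using z False by (auto simp: continuous_on_eq_continuous_within)
      then obtain d where d: "d > 0" "\<And>s. s \<in> {0..} \<Longrightarrow> dist s t < d \<Longrightarrow> dist (z s) (z t) < z t"
        using zt unfolding continuous_within_eps_delta by meson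
      obtain a where a: "a \<in> \<rat>" "max 0 (t - d) < a" "a < t" using Rats_dense_in_real[of "max 0 (t - d)" t] False d by auto
      obtain b where b: "b \<in> \<rat>" "t < b" "b < t + d" using Rats_dense_in_real[of t "t + d"] d by auto
      have "0 < z s" if "s \<in> {a..b}" for s
      proof -
        have "dist s t < d" "s \<in> {0..}" using that a b by (auto simp: dist_real_def abs_less_iff)
        then have "\<bar>z s - z t\<bar> < z t" using d(2)[of s] by (simp add: dist_real_def)
        then show ?thesis by linarith
      qed
      then have "(a, b) \<in> Q" using a b by (auto simp: Q_def)
      then show ?thesis using a b by (auto simp: N_def intro!: bexI[of _ "(a,b)"])
    qed
  qed
  then have "(\<integral>\<^sup>+ t. ennreal (z t) \<partial>?M) = (\<integral>\<^sup>+ t. 0 \<partial>?M)" by (rule nn_integral_cong_AE)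
  then show ?thesis by simp
qed

section \<open>The Skorokhod problem for a matrix of contraction type\<close>

text \<open>The weights \<open>u\<close> make \<open>I - R\<close> a contraction with factor \<open>\<theta>\<close> in the norm
  \<open>Max {\<bar>x i\<bar> / u i | i \<in> I}\<close>; unlike a spectral radius bound, this passes at once to
  principal submatrices.\<close>

locale skorokhod_problem =
  fixes I :: "nat set" and R :: "nat \<Rightarrow> nat \<Rightarrow> real" and u :: "nat \<Rightarrow> real" and \<theta> :: real
  assumes finite_I: "finite I"
    and R_diag: "\<And>i. i \<in> I \<Longrightarrow> R i i = 1"
    and R_offdiag: "\<And>i j. i \<in> I \<Longrightarrow> j \<in> I \<Longrightarrow> i \<noteq> j \<Longrightarrow> R i j \<le> 0"
    and u_pos: "\<And>i. i \<in> I \<Longrightarrow> 0 < u i"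
    and \<theta>: "0 \<le> \<theta>" "\<theta> < 1"
    and contr: "\<And>i. i \<in> I \<Longrightarrow> (\<Sum>j\<in>I. ((if i = j then 1 else 0) - R i j) * u j) \<le> \<theta> * u i"
begin

text \<open>In vector form (I - R) L - X, so \<open>L\<close> minus \<open>drive\<close> is the
  reflected path X + R L. As \<open>R i i = 1\<close>, coordinate \<open>i\<close> of
  \<open>L\<close> drops out, and \<open>L t i = runmax (drive X L i) t\<close> is the
  one-dimensional reflection formula with the other coordinates given: the problem becomes a
  fixed-point equation.\<close>

definition drive :: "(real \<Rightarrow> nat \<Rightarrow> real) \<Rightarrow> (real \<Rightarrow> nat \<Rightarrow> real) \<Rightarrow> nat \<Rightarrow> real \<Rightarrow> real" where
  "drive X L i t = (\<Sum>j\<in>I. ((if i = j then 1 else 0) - R i j) * L t j) - X t i"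

fun picard :: "nat \<Rightarrow> (real \<Rightarrow> nat \<Rightarrow> real) \<Rightarrow> real \<Rightarrow> nat \<Rightarrow> real" where
  "picard 0 X t i = 0"
| "picard (Suc n) X t i = runmax (drive X (picard n X) i) t"

text \<open>The limit of the Picard iterates, written as a telescoping series so that the M-test
  gives convergence and measurability is that of a series.\<close>

definition regulator :: "(real \<Rightarrow> nat \<Rightarrow> real) \<Rightarrow> real \<Rightarrow> nat \<Rightarrow> real" where
  "regulator X t i = (\<Sum>n. picard (Suc n) X t i - picard n X t i)"

lemma drive_eq: "i \<in> I \<Longrightarrow> drive X L i t = L t i - (X t i + (\<Sum>j\<in>I. R i j * L t j))"
  using finite_I by (simp add: drive_def left_diff_distrib sum_subtractf if_distrib[of "\<lambda>x. x * _"] cong: if_cong)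

lemma P_nonneg: "i \<in> I \<Longrightarrow> j \<in> I \<Longrightarrow> 0 \<le> (if i = j then 1 else 0) - R i j"
  using R_diag R_offdiag by auto

lemma drive_continuous:
  assumes "\<And>j. j \<in> I \<Longrightarrow> continuous_on S (\<lambda>t. X t j)" "\<And>j. j \<in> I \<Longrightarrow> continuous_on S (\<lambda>t. L t j)" "i \<in> I"
  shows "continuous_on S (drive X L i)"
  unfolding drive_def[abs_def] using assms by (auto intro!: continuous_intros)

text \<open>Running maxima are 1-Lipschitz, and since the entries of I - R are nonnegative the
  absolute values can be moved onto \<open>L - L'\<close>, where the weighted row sums
  \<open>contr\<close> apply.\<close>

lemma contraction:
  assumes X: "\<And>j. j \<in> I \<Longrightarrow> continuous_on {0..T} (\<lambda>t. X t j)"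
    and L: "\<And>j. j \<in> I \<Longrightarrow> continuous_on {0..T} (\<lambda>t. L t j)"
    and L': "\<And>j. j \<in> I \<Longrightarrow> continuous_on {0..T} (\<lambda>t. L' t j)"
    and le: "\<And>s j. 0 \<le> s \<Longrightarrow> s \<le> T \<Longrightarrow> j \<in> I \<Longrightarrow> \<bar>L s j - L' s j\<bar> \<le> K * u j"
    and t: "0 \<le> t" "t \<le> T" and i: "i \<in> I"
  shows "\<bar>runmax (drive X L i) t - runmax (drive X L' i) t\<bar> \<le> \<theta> * K * u i"
proof (rule runmax_diff)
  \<comment> \<open>The sign of \<open>K\<close> follows from the assumed bound itself, evaluated at
    time 0.\<close>
  have "0 \<le> K * u i" using le[of 0 i] t i by linarith
  then have K: "0 \<le> K" using u_pos[OF i] by (simp add: zero_le_mult_iff)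
  show "continuous_on {0..t} (drive X L i)" "continuous_on {0..t} (drive X L' i)"
    using t i by (auto intro!: drive_continuous intro: continuous_on_subset[OF X] continuous_on_subset[OF L] continuous_on_subset[OF L'])
  fix s assume s: "0 \<le> s" "s \<le> t"
  let ?P = "\<lambda>j. (if i = j then 1 else 0) - R i j"
  have "drive X L i s - drive X L' i s = (\<Sum>j\<in>I. ?P j * (L s j - L' s j))"
    by (simp add: drive_def sum_subtractf right_diff_distrib)
  also have "\<bar>\<dots>\<bar> \<le> (\<Sum>j\<in>I. \<bar>?P j * (L s j - L' s j)\<bar>)" by (rule sum_abs)
  also have "\<dots> \<le> (\<Sum>j\<in>I. K * (?P j * u j))"
  proof (rule sum_mono)
    fix j assume j: "j \<in> I"
    have "\<bar>?P j * (L s j - L' s j)\<bar> = ?P j * \<bar>L s j - L' s j\<bar>"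
      using P_nonneg[OF i j] by (simp only: abs_mult abs_of_nonneg)
    also have "\<dots> \<le> ?P j * (K * u j)"
      using P_nonneg[OF i j] le[of s j] s t j by (intro mult_left_mono) auto
    finally show "\<bar>?P j * (L s j - L' s j)\<bar> \<le> K * (?P j * u j)" by (simp only: mult.left_commute)
  qed
  also have "\<dots> = K * (\<Sum>j\<in>I. ?P j * u j)" by (simp only: sum_distrib_left)
  also have "\<dots> \<le> K * (\<theta> * u i)" by (rule mult_left_mono[OF contr[OF i] K])
  finally show "\<bar>drive X L i s - drive X L' i s\<bar> \<le> \<theta> * K * u i" by (simp add: mult_ac)
qed (rule t)

lemma weighted_bound:
  fixes f :: "real \<Rightarrow> nat \<Rightarrow> real"
  assumes "\<And>j. j \<in> I \<Longrightarrow> continuous_on {0..T} (\<lambda>t. f t j)"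
  obtains K :: real where "\<And>t j. 0 \<le> t \<Longrightarrow> t \<le> T \<Longrightarrow> j \<in> I \<Longrightarrow> \<bar>f t j\<bar> \<le> K * u j"
proof -
  have "\<exists>k. \<forall>t\<in>{0..T}. \<bar>f t j\<bar> \<le> k" if "j \<in> I" for j
  proof -
    have "bounded ((\<lambda>t. f t j) ` {0..T})"
      by (intro compact_imp_bounded compact_continuous_image assms that) auto
    then show ?thesis by (auto simp: bounded_iff)
  qed
  then obtain k where k: "\<And>j t. j \<in> I \<Longrightarrow> t \<in> {0..T} \<Longrightarrow> \<bar>f t j\<bar> \<le> k j" by metis
  define K where "K = (\<Sum>j\<in>I. \<bar>k j\<bar> / u j)"
  show ?thesis
  proof (rule that[of K])
    fix t j assume t: "0 \<le> t" "t \<le> T" and j: "j \<in> I"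
    have "\<bar>k j\<bar> / u j \<le> K" unfolding K_def
      by (rule member_le_sum[OF j]) (use finite_I u_pos in \<open>auto simp: less_imp_le\<close>)
    then have "\<bar>k j\<bar> \<le> K * u j" using u_pos[OF j] by (simp add: pos_divide_le_eq)
    then show "\<bar>f t j\<bar> \<le> K * u j" using k[of j t] j t by auto
  qed
qed

section \<open>Uniqueness and existence of the fixed point\<close>

text \<open>Two solutions have a finite weighted distance \<open>K\<close> on the compact interval;
  inserting the fixed-point equations \<open>n\<close> times shrinks it to
  \<open>\<theta> ^ n * K\<close>.\<close>

lemma uniqueness:
  assumes X: "\<And>j. j \<in> I \<Longrightarrow> continuous_on {0..T} (\<lambda>t. X t j)"
    and L: "\<And>j. j \<in> I \<Longrightarrow> continuous_on {0..T} (\<lambda>t. L t j)"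
    and L': "\<And>j. j \<in> I \<Longrightarrow> continuous_on {0..T} (\<lambda>t. L' t j)"
    and fp: "\<And>t j. 0 \<le> t \<Longrightarrow> t \<le> T \<Longrightarrow> j \<in> I \<Longrightarrow> L t j = runmax (drive X L j) t"
    and fp': "\<And>t j. 0 \<le> t \<Longrightarrow> t \<le> T \<Longrightarrow> j \<in> I \<Longrightarrow> L' t j = runmax (drive X L' j) t"
    and t: "0 \<le> t" "t \<le> T" and i: "i \<in> I"
  shows "L t i = L' t i"
proof -
  obtain K where K: "\<And>t j. 0 \<le> t \<Longrightarrow> t \<le> T \<Longrightarrow> j \<in> I \<Longrightarrow> \<bar>L t j - L' t j\<bar> \<le> K * u j"
    using weighted_bound[of T "\<lambda>t j. L t j - L' t j", OF continuous_on_diff[OF L L']] by blast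
  have bd: "\<bar>L t j - L' t j\<bar> \<le> (\<theta> ^ n * K) * u j" if "0 \<le> t" "t \<le> T" "j \<in> I" for n t j
    using that
  proof (induction n arbitrary: t j)
    case 0 then show ?case using K by simp
  next
    case (Suc n)
    have "\<bar>runmax (drive X L j) t - runmax (drive X L' j) t\<bar> \<le> \<theta> * (\<theta> ^ n * K) * u j"
      by (rule contraction[where T=T]) (use X L L' Suc in auto)
    then show ?case using fp fp' Suc.prems by (simp add: mult_ac)
  qed
  have "(\<lambda>n. (\<theta> ^ n * K) * u i) \<longlonglongrightarrow> (0 * K) * u i"
    by (intro tendsto_intros LIMSEQ_realpow_zero) (use \<theta> in auto)
  then have "\<bar>L t i - L' t i\<bar> \<le> 0"
    by (intro LIMSEQ_le_const[where X="\<lambda>n. (\<theta> ^ n * K) * u i"]) (use bd[OF t i] in auto)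
  then show ?thesis by simp
qed

lemma picard_continuous:
  assumes X: "\<And>j. j \<in> I \<Longrightarrow> continuous_on {0..T} (\<lambda>t. X t j)" and i: "i \<in> I"
  shows "continuous_on {0..T} (\<lambda>t. picard n X t i)"
  using i
proof (induction n arbitrary: i)
  case (Suc n)
  then show ?case using X by (auto intro!: runmax_continuous drive_continuous)
qed simp

text \<open>Consecutive iterates differ by a geometrically decaying amount, again by repeated
  contraction, and the M-test applies.\<close>

lemma regulator_uniform_limit:
  assumes X: "\<And>j. j \<in> I \<Longrightarrow> continuous_on {0..T} (\<lambda>t. X t j)" and i: "i \<in> I"
  shows "uniform_limit {0..T} (\<lambda>n t. picard n X t i) (\<lambda>t. regulator X t i) sequentially"
proof -
  obtain K where K: "\<And>t j. 0 \<le> t \<Longrightarrow> t \<le> T \<Longrightarrow> j \<in> I \<Longrightarrow> \<bar>picard (Suc 0) X t j - picard 0 X t j\<bar> \<le> K * u j"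
    using weighted_bound[of T "\<lambda>t j. picard (Suc 0) X t j - picard 0 X t j",
        OF continuous_on_diff[OF picard_continuous[OF X] picard_continuous[OF X]]] by blast
  have bd: "\<bar>picard (Suc n) X t j - picard n X t j\<bar> \<le> (\<theta> ^ n * K) * u j" if "0 \<le> t" "t \<le> T" "j \<in> I" for n t j
    using that
  proof (induction n arbitrary: t j)
    case 0 then show ?case using K[OF 0] by simp
  next
    case (Suc n)
    have "\<bar>runmax (drive X (picard (Suc n) X) j) t - runmax (drive X (picard n X) j) t\<bar> \<le> \<theta> * (\<theta> ^ n * K) * u j"
      by (rule contraction[where T=T]) (use X picard_continuous[OF X] Suc in \<open>auto simp del: picard.simps(2)\<close>)
    then show ?case by (simp add: mult_ac)
  qed
  have "uniform_limit {0..T} (\<lambda>n t. \<Sum>k<n. picard (Suc k) X t i - picard k X t i) (\<lambda>t. regulator X t i) sequentially"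
    unfolding regulator_def
  proof (rule Weierstrass_m_test)
    show "norm (picard (Suc n) X t i - picard n X t i) \<le> (\<theta> ^ n * K) * u i" if "t \<in> {0..T}" for n t
      using bd[of t i n] that i by simp
    show "summable (\<lambda>n. \<theta> ^ n * K * u i)"
      by (intro summable_mult2 summable_geometric) (use \<theta> in auto)
  qed
  moreover have "(\<Sum>k<n. picard (Suc k) X t i - picard k X t i) = picard n X t i" for n t
    using sum_lessThan_telescope[of "\<lambda>k. picard k X t i" n] by simp
  ultimately show ?thesis by simp
qed

lemma regulator_continuous_Icc:
  assumes X: "\<And>j. j \<in> I \<Longrightarrow> continuous_on {0..T} (\<lambda>t. X t j)" and i: "i \<in> I"
  shows "continuous_on {0..T} (\<lambda>t. regulator X t i)"
  by (rule uniform_limit_theorem[OF _ regulator_uniform_limit[OF X i]])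
    (use picard_continuous[OF X] i in auto)

lemma regulator_fixpoint:
  assumes X: "\<And>j. j \<in> I \<Longrightarrow> continuous_on {0..T} (\<lambda>t. X t j)" and i: "i \<in> I"
    and t: "0 \<le> t" "t \<le> T"
  shows "regulator X t i = runmax (drive X (regulator X) i) t"
proof (rule LIMSEQ_unique)
  have lim: "(\<lambda>n. picard n X t i) \<longlonglongrightarrow> regulator X t i"
    using tendsto_uniform_limitI[OF regulator_uniform_limit[OF X i]] t by auto
  then show "(\<lambda>n. picard (Suc n) X t i) \<longlonglongrightarrow> regulator X t i" by (rule LIMSEQ_Suc)
  show "(\<lambda>n. picard (Suc n) X t i) \<longlonglongrightarrow> runmax (drive X (regulator X) i) t"
  proof (rule tendstoI)
    fix e :: real assume e: "e > 0"
    \<comment> \<open>Chosen so that \<open>K * u i = e\<close>; after one contraction the error in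
      coordinate \<open>i\<close> is at most \<open>\<theta> * e < e\<close>.\<close>
    define K where "K = e / (u i)"
    have K: "K > 0" using e u_pos[OF i] by (simp add: K_def)
    have "\<forall>\<^sub>F n in sequentially. \<forall>s\<in>{0..T}. dist (picard n X s j) (regulator X s j) < K * u j" if "j \<in> I" for j
      by (rule uniform_limitD[OF regulator_uniform_limit[OF X that]]) (use K u_pos[OF that] in auto)
    then have "\<forall>\<^sub>F n in sequentially. \<forall>j\<in>I. \<forall>s\<in>{0..T}. dist (picard n X s j) (regulator X s j) < K * u j"
      using finite_I by (simp add: eventually_ball_finite)
    then show "\<forall>\<^sub>F n in sequentially. dist (picard (Suc n) X t i) (runmax (drive X (regulator X) i) t) < e"
    proof eventually_elim
      case (elim n)
      have "\<bar>runmax (drive X (picard n X) i) t - runmax (drive X (regulator X) i) t\<bar> \<le> \<theta> * K * u i"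
      proof (rule contraction[where T=T])
        show "\<bar>picard n X s j - regulator X s j\<bar> \<le> K * u j" if "0 \<le> s" "s \<le> T" "j \<in> I" for s j
          using elim that by (auto simp: dist_real_def less_imp_le)
      qed (use X t i picard_continuous[OF X] regulator_continuous_Icc[OF X] in auto)
      also have "\<theta> * K * u i = \<theta> * e" using u_pos[OF i] by (simp add: K_def)
      also have "\<dots> < e" using e \<theta> by simp
      finally show ?case by (simp add: dist_real_def)
    qed
  qed
qed

lemma regulator_continuous:
  assumes "\<And>j. j \<in> I \<Longrightarrow> continuous_on {0..} (\<lambda>t. X t j)" and i: "i \<in> I"
  shows "continuous_on {0..} (\<lambda>t. regulator X t i)"
  by (intro continuous_on_atLeastI regulator_continuous_Icc i continuous_on_subset[OF assms(1)]) auto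

text \<open>With a start in the orthant, a regulator vanishing at time 0 gives
  \<open>drive X L i 0 \<le> 0\<close>, so every iterate keeps the value 0 there.\<close>

lemma regulator_zero:
  assumes "\<And>j. j \<in> I \<Longrightarrow> 0 \<le> X 0 j" "i \<in> I"
  shows "regulator X 0 i = 0"
proof -
  have "picard n X 0 i = 0" if "i \<in> I" for n i
    using that
  proof (induction n arbitrary: i)
    case (Suc n)
    then show ?case using assms(1) by (simp add: runmax_zero drive_def)
  qed simp
  then show ?thesis using assms by (simp only: regulator_def) simp
qed

section \<open>The fixed point solves the Skorokhod problem\<close>

context
  fixes X :: "real \<Rightarrow> nat \<Rightarrow> real"
  assumes X: "\<And>j. j \<in> I \<Longrightarrow> continuous_on {0..} (\<lambda>t. X t j)"
begin

lemma regulator_runmax: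
  assumes "i \<in> I" "0 \<le> t"
  shows "regulator X t i = runmax (drive X (regulator X) i) t"
  by (rule regulator_fixpoint[where T=t]) (use assms in \<open>auto intro: continuous_on_subset[OF X]\<close>)

lemma regulator_drive_continuous:
  assumes "i \<in> I"
  shows "continuous_on {0..T} (drive X (regulator X) i)"
  using assms by (auto intro!: drive_continuous intro: continuous_on_subset[OF X] continuous_on_subset[OF regulator_continuous[OF X]])

lemma regulator_mono:
  assumes i: "i \<in> I"
  shows "mono_on {0..} (\<lambda>t. regulator X t i)"
proof (rule mono_onI)
  fix r s :: real assume "r \<in> {0..}" "s \<in> {0..}" "r \<le> s"
  then show "regulator X r i \<le> regulator X s i"
    using runmax_mono[OF regulator_drive_continuous[OF i], of r s] regulator_runmax[OF i] by simp
qed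

lemma reflected_nonneg:
  assumes i: "i \<in> I" and t: "0 \<le> t"
  shows "0 \<le> X t i + (\<Sum>j\<in>I. R i j * regulator X t j)"
  using runmax_upper(1)[OF regulator_drive_continuous[OF i], of t t] t
  by (simp add: regulator_runmax[OF i t, symmetric] drive_eq[OF i])

lemma regulator_flat:
  assumes i: "i \<in> I" and ab: "0 \<le> a" "a \<le> b"
    and pos: "\<And>s. a \<le> s \<Longrightarrow> s \<le> b \<Longrightarrow> 0 < X s i + (\<Sum>j\<in>I. R i j * regulator X s j)"
  shows "regulator X a i = regulator X b i"
proof -
  have "runmax (drive X (regulator X) i) a = runmax (drive X (regulator X) i) b"
  proof (rule runmax_flat[OF regulator_drive_continuous[OF i] ab])
    fix s assume "a \<le> s" "s \<le> b"
    then show "drive X (regulator X) i s < runmax (drive X (regulator X) i) s"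
      using pos[of s] regulator_runmax[OF i, of s] ab by (simp add: drive_eq[OF i])
  qed
  then show ?thesis using regulator_runmax[OF i] ab by simp
qed

text \<open>The conditions on \<open>L\<close> reach only to \<open>T\<close>: the increments of the
  original regulators solve the reduced problem only while the coordinates outside \<open>I\<close>
  stay positive.\<close>

lemma regulator_unique:
  assumes L: "\<And>j. j \<in> I \<Longrightarrow> continuous_on {0..T} (\<lambda>t. L t j)"
    and L0: "\<And>j. j \<in> I \<Longrightarrow> L 0 j = 0"
    and mono: "\<And>j. j \<in> I \<Longrightarrow> mono_on {0..T} (\<lambda>t. L t j)"
    and nn: "\<And>s j. 0 \<le> s \<Longrightarrow> s \<le> T \<Longrightarrow> j \<in> I \<Longrightarrow> 0 \<le> X s j + (\<Sum>k\<in>I. R j k * L s k)"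
    and flat: "\<And>j a b. j \<in> I \<Longrightarrow> 0 \<le> a \<Longrightarrow> a \<le> b \<Longrightarrow> b \<le> T \<Longrightarrow>
      (\<And>s. a \<le> s \<Longrightarrow> s \<le> b \<Longrightarrow> 0 < X s j + (\<Sum>k\<in>I. R j k * L s k)) \<Longrightarrow> L a j = L b j"
    and t: "0 \<le> t" "t \<le> T" and i: "i \<in> I"
  shows "L t i = regulator X t i"
proof (rule uniqueness[where X=X and T=T and L=L and L'="regulator X"])
  have XT: "\<And>j. j \<in> I \<Longrightarrow> continuous_on {0..T} (\<lambda>t. X t j)"
    by (rule continuous_on_subset[OF X]) auto
  show "L t j = runmax (drive X L j) t" if "0 \<le> t" "t \<le> T" "j \<in> I" for t j
  proof (rule reflection_formula[where T=T and l="\<lambda>t. L t j"])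
    show "continuous_on {0..T} (drive X L j)" by (rule drive_continuous[OF XT L that(3)])
    show "L a j = L b j" if "0 \<le> a" "a \<le> b" "b \<le> T" "\<And>s. a \<le> s \<Longrightarrow> s \<le> b \<Longrightarrow> drive X L j s < L s j" for a b
    proof (rule flat)
      show "0 < X s j + (\<Sum>k\<in>I. R j k * L s k)" if "a \<le> s" "s \<le> b" for s
        using \<open>\<And>s. a \<le> s \<Longrightarrow> s \<le> b \<Longrightarrow> drive X L j s < L s j\<close>[OF that] drive_eq[OF \<open>j \<in> I\<close>, of X L s] by linarith
    qed (use that \<open>j \<in> I\<close> in auto)
    show "drive X L j s \<le> L s j" if "0 \<le> s" "s \<le> T" for s
      using nn[OF that \<open>j \<in> I\<close>] drive_eq[OF \<open>j \<in> I\<close>, of X L s] by linarith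
  qed (use that L L0 mono in auto)
  show "\<And>t j. 0 \<le> t \<Longrightarrow> t \<le> T \<Longrightarrow> j \<in> I \<Longrightarrow> regulator X t j = runmax (drive X (regulator X) j) t"
    by (rule regulator_runmax)
qed (use L t i in \<open>auto intro: continuous_on_subset[OF X] continuous_on_subset[OF regulator_continuous[OF X]]\<close>)

end

section \<open>Measurability of the regulator\<close>

lemma picard_measurable:
  assumes m: "\<And>s j. 0 \<le> s \<Longrightarrow> s \<le> t \<Longrightarrow> j \<in> I \<Longrightarrow> (\<lambda>\<omega>. X s \<omega> j) \<in> borel_measurable N"
    and c: "\<And>\<omega> j. \<omega> \<in> space N \<Longrightarrow> j \<in> I \<Longrightarrow> continuous_on {0..t} (\<lambda>s. X s \<omega> j)"
    and "0 \<le> s" "s \<le> t" "i \<in> I"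
  shows "(\<lambda>\<omega>. picard n (\<lambda>r. X r \<omega>) s i) \<in> borel_measurable N"
  using assms(3-)
proof (induction n arbitrary: s i)
  case (Suc n)
  have "(\<lambda>\<omega>. runmax (\<lambda>r. drive (\<lambda>r. X r \<omega>) (picard n (\<lambda>r. X r \<omega>)) i r) s) \<in> borel_measurable N"
  proof (rule runmax_measurable)
    fix r assume "0 \<le> r" "r \<le> s"
    then show "(\<lambda>\<omega>. drive (\<lambda>r. X r \<omega>) (picard n (\<lambda>r. X r \<omega>)) i r) \<in> borel_measurable N"
      unfolding drive_def using Suc m[of r]
      by (intro borel_measurable_diff borel_measurable_sum borel_measurable_times) auto
  next
    fix \<omega> assume "\<omega> \<in> space N"
    then show "continuous_on {0..s} (drive (\<lambda>r. X r \<omega>) (picard n (\<lambda>r. X r \<omega>)) i)"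
      using Suc.prems by (intro drive_continuous picard_continuous) (auto intro: continuous_on_subset[OF c])
  qed (rule Suc.prems)
  then show ?case by simp
qed simp

text \<open>Serves twice: with \<open>N = F t\<close> for adaptedness, and with a product
  sigma-algebra for joint measurability in starting point and noise.\<close>

lemma regulator_measurable:
  assumes "\<And>s j. 0 \<le> s \<Longrightarrow> s \<le> t \<Longrightarrow> j \<in> I \<Longrightarrow> (\<lambda>\<omega>. X s \<omega> j) \<in> borel_measurable N"
    and "\<And>\<omega> j. \<omega> \<in> space N \<Longrightarrow> j \<in> I \<Longrightarrow> continuous_on {0..t} (\<lambda>s. X s \<omega> j)"
    and "0 \<le> t" "i \<in> I"
  shows "(\<lambda>\<omega>. regulator (\<lambda>r. X r \<omega>) t i) \<in> borel_measurable N"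
  unfolding regulator_def
  by (intro borel_measurable_suminf borel_measurable_diff picard_measurable[OF assms(1,2)]) (use assms in auto)

end

section \<open>Reflection matrices are contractions\<close>

definition apply_mat :: "nat \<Rightarrow> (nat \<Rightarrow> nat \<Rightarrow> real) \<Rightarrow> (nat \<Rightarrow> real) \<Rightarrow> nat \<Rightarrow> real" where
  "apply_mat d P w i = (\<Sum>j<d. P i j * w j)"

text \<open>Translates between complex matrix powers, for which spectral bounds are available, and
  the iteration of a real matrix on functions.\<close>

lemma pow_mat_apply:
  fixes P :: "nat \<Rightarrow> nat \<Rightarrow> real" and d :: nat
  defines "B \<equiv> mat d d (\<lambda>(i,j). complex_of_real (P i j))"
  shows "B ^\<^sub>m k *\<^sub>v vec d (\<lambda>i. complex_of_real (w i)) = vec d (\<lambda>i. complex_of_real ((apply_mat d P ^^ k) w i))"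
proof (induction k arbitrary: w)
  case 0
  have "B ^\<^sub>m 0 = 1\<^sub>m d" by (simp add: B_def)
  then show ?case by simp
next
  case (Suc k)
  have B: "B \<in> carrier_mat d d" by (simp add: B_def)
  have "B ^\<^sub>m Suc k *\<^sub>v vec d (\<lambda>i. complex_of_real (w i)) = B ^\<^sub>m k *\<^sub>v (B *\<^sub>v vec d (\<lambda>i. complex_of_real (w i)))"
    by (simp add: assoc_mult_mat_vec[OF pow_carrier_mat[OF B] B])
  also have "B *\<^sub>v vec d (\<lambda>i. complex_of_real (w i)) = vec d (\<lambda>i. complex_of_real (apply_mat d P w i))"
    by (rule eq_vecI) (auto simp: B_def apply_mat_def scalar_prod_def lessThan_atLeast0)
  finally show ?case by (simp add: Suc funpow_swap1 del: pow_mat.simps)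
qed

text \<open>An eigenvalue of the scaled matrix divided by \<open>c\<close> is an eigenvalue of
  \<open>A\<close> with the same eigenvector.\<close>

lemma spectral_radius_smult_less_1:
  assumes A: "A \<in> carrier_mat n n" and n: "0 < n" and c: "0 < c" "c * spectral_radius A < 1"
  shows "spectral_radius (complex_of_real c \<cdot>\<^sub>m A) < 1"
proof -
  let ?B = "complex_of_real c \<cdot>\<^sub>m A"
  have B: "?B \<in> carrier_mat n n" using A by simp
  obtain k where k: "k \<in> spectrum ?B" "spectral_radius ?B = norm k"
    using spectral_radius_mem_max(1)[OF B n] by auto
  then obtain v where v: "v \<in> carrier_vec n" "v \<noteq> 0\<^sub>v n" "?B *\<^sub>v v = k \<cdot>\<^sub>v v"
    using A by (auto simp: spectrum_def eigenvalue_def eigenvector_def)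
  have "complex_of_real c \<cdot>\<^sub>v (A *\<^sub>v v) = k \<cdot>\<^sub>v v"
  proof -
    have "?B *\<^sub>v v = complex_of_real c \<cdot>\<^sub>v (A *\<^sub>v v)"
      by (rule eq_vecI) (use A v(1) in \<open>auto simp: scalar_prod_def sum_distrib_left mult.assoc intro!: sum.cong\<close>)
    then show ?thesis using v(3) by simp
  qed
  then have "(1 / complex_of_real c) \<cdot>\<^sub>v (complex_of_real c \<cdot>\<^sub>v (A *\<^sub>v v)) = (1 / complex_of_real c) \<cdot>\<^sub>v (k \<cdot>\<^sub>v v)"
    by simp
  then have "A *\<^sub>v v = (k / complex_of_real c) \<cdot>\<^sub>v v"
    using c by (simp add: smult_smult_assoc)
  then have "k / complex_of_real c \<in> spectrum A"
    using v A by (auto simp: spectrum_def eigenvalue_def eigenvector_def intro!: exI[of _ v])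
  then have "norm (k / complex_of_real c) \<le> spectral_radius A"
    by (intro spectral_radius_mem_max(2)[OF A n]) auto
  then have "norm k \<le> c * spectral_radius A" using c by (simp add: norm_divide pos_divide_le_eq mult.commute)
  then show ?thesis using c k by simp
qed

text \<open>With \<open>v k\<close> = P^k 1 and \<open>u\<close> the sum of \<open>v k\<close> over
  \<open>k < N\<close>, telescoping gives P u = u + v N - 1. Once \<open>v N \<le> 1/2\<close>, this
  is at most u - 1/2, a uniform gain that turns into a factor below 1 because \<open>u\<close> is
  bounded.\<close>

lemma reflection_M_matrix_weights:
  assumes R: "reflection_nonsingular_M_matrix d R" and d: "1 \<le> d"
  obtains u :: "nat \<Rightarrow> real" and \<theta> :: real where
    "\<And>i. i < d \<Longrightarrow> 0 < u i" "0 \<le> \<theta>" "\<theta> < 1"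
    "\<And>i. i < d \<Longrightarrow> (\<Sum>j<d. ((if i = j then 1 else 0) - R i j) * u j) \<le> \<theta> * u i"
proof -
  define P where "P i j = (if i = j then 1 else 0) - R i j" for i j
  have P0: "0 \<le> P i j" if "i < d" "j < d" for i j
    using R that by (auto simp: P_def reflection_nonsingular_M_matrix_def)
  define A where "A = id_minus_mat d R"
  have A: "A \<in> carrier_mat d d" by (simp add: A_def id_minus_mat_def)
  have A1: "spectral_radius A < 1" using R by (simp add: A_def reflection_nonsingular_M_matrix_def)
  have d0: "0 < d" using d by simp
  have A0: "0 \<le> spectral_radius A" using spectral_radius_mem_max(1)[OF A d0] by auto
  \<comment> \<open>Any factor above 1 that keeps the spectral radius of c P below 1 would do.
    Boundedness of the powers of c P then means that those of P decay like c^(-k).\<close>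
  define c where "c = 2 / (1 + spectral_radius A)"
  have c: "1 < c" "c * spectral_radius A < 1" using A0 A1 by (auto simp: c_def field_simps)
  define B where "B = mat d d (\<lambda>(i,j). complex_of_real (c * P i j))"
  have BA: "B = complex_of_real c \<cdot>\<^sub>m A"
    by (rule eq_matI) (auto simp: B_def A_def id_minus_mat_def P_def)
  have B: "B \<in> carrier_mat d d" by (simp add: B_def)
  have "spectral_radius B < 1"
    unfolding BA by (rule spectral_radius_smult_less_1[OF A d0]) (use c in auto)
  then obtain C where C: "\<And>k. norm_bound (B ^\<^sub>m k) C"
    using spectral_radius_jnf_norm_bound_less_1_upper_triangular[OF B] by blast
  define v where "v k = (apply_mat d P ^^ k) (\<lambda>_. 1)" for k
  have v0: "v 0 i = 1" for i by (simp add: v_def)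
  have vS: "v (Suc k) i = (\<Sum>j<d. P i j * v k j)" for k i by (simp add: v_def apply_mat_def)
  have vnn: "0 \<le> v k i" if "i < d" for k i
    using that by (induction k arbitrary: i) (auto simp: v0 vS intro!: sum_nonneg mult_nonneg_nonneg P0)
  have sc: "(apply_mat d (\<lambda>i j. c * P i j) ^^ k) (\<lambda>_. 1) i = c ^ k * v k i" for k i
  proof (induction k arbitrary: i)
    case (Suc k)
    then show ?case by (simp add: vS apply_mat_def sum_distrib_left mult_ac)
  qed (simp add: v0)
  have bd: "c ^ k * v k i \<le> real d * C" if i: "i < d" for k i
  proof -
    have Bk: "B ^\<^sub>m k \<in> carrier_mat d d" by (rule pow_carrier_mat[OF B])
    have "complex_of_real (c ^ k * v k i) = (B ^\<^sub>m k *\<^sub>v vec d (\<lambda>i. complex_of_real 1)) $ i"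
      unfolding B_def by (subst pow_mat_apply) (use i sc in auto)
    also have "\<dots> = (\<Sum>j<d. (B ^\<^sub>m k) $$ (i, j))"
    proof -
      have "dim_row (B ^\<^sub>m k) = d" "dim_col (B ^\<^sub>m k) = d" using Bk by auto
      then show ?thesis using i by (simp add: scalar_prod_def lessThan_atLeast0)
    qed
    also have "norm \<dots> \<le> (\<Sum>j<d. C)"
    proof (rule sum_norm_le)
      fix j assume "j \<in> {..<d}"
      moreover have "dim_row (B ^\<^sub>m k) = d" "dim_col (B ^\<^sub>m k) = d" using Bk by auto
      ultimately show "norm ((B ^\<^sub>m k) $$ (i, j)) \<le> C"
        using C[of k] i unfolding norm_bound_def by simp
    qed
    finally have "norm (complex_of_real (c ^ k * v k i)) \<le> real d * C" by simp
    then have "\<bar>c ^ k * v k i\<bar> \<le> real d * C" unfolding norm_of_real .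
    then show ?thesis by linarith
  qed
  obtain N where N: "real d * C < (1/2) * c ^ N"
  proof -
    obtain N where "2 * (real d * C) < c ^ N" using real_arch_pow[OF c(1)] by blast
    then show ?thesis by (intro that[of N]) linarith
  qed
  have vN: "v N i \<le> 1/2" if "i < d" for i
  proof -
    have "c ^ N * v N i \<le> c ^ N * (1/2)" using bd[OF that, of N] N by linarith
    then show ?thesis using c by (simp only: mult_le_cancel_left_pos zero_less_power)
  qed
  \<comment> \<open>Thus the sum defining \<open>u\<close> contains the term \<open>v 0 = 1\<close>,
    whence \<open>u \<ge> 1\<close>.\<close>
  have "N \<noteq> 0" using vN[OF d0] v0[of 0] by (cases N) auto
  define u where "u i = (\<Sum>k<N. v k i)" for i
  have u1: "1 \<le> u i" if "i < d" for i
    using member_le_sum[of 0 "{..<N}" "\<lambda>k. v k i"] vnn[OF that] \<open>N \<noteq> 0\<close> by (simp add: u_def v0)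
  have Pu: "(\<Sum>j<d. P i j * u j) \<le> u i - 1/2" if "i < d" for i
  proof -
    have "(\<Sum>j<d. P i j * u j) = (\<Sum>k<N. v (Suc k) i)"
      unfolding u_def vS sum_distrib_left by (rule sum.swap)
    also have "\<dots> = u i + (v N i - v 0 i)"
      using sum_lessThan_telescope[of "\<lambda>k. v k i" N] by (simp add: u_def sum_subtractf)
    finally show ?thesis using vN[OF that] v0[of i] by simp
  qed
  define U where "U = (\<Sum>i<d. u i)"
  have uU: "u i \<le> U" if "i < d" for i
    unfolding U_def by (rule member_le_sum) (use that u1 in \<open>force+\<close>)
  have U: "1 \<le> U" using u1[OF d0] uU[OF d0] by simp
  show ?thesis
  \<comment> \<open>Since \<open>u i \<le> U\<close>, the loss 1/2 is at least
    \<open>u i / (2 * U)\<close>, which yields this factor.\<close>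
  proof (rule that[of u "1 - 1 / (2 * U)"])
    show "0 < u i" if "i < d" for i using u1[OF that] by simp
    show "0 \<le> 1 - 1 / (2 * U)" "1 - 1 / (2 * U) < 1" using U by (auto simp: field_simps)
    fix i assume i: "i < d"
    have "u i / (2 * U) \<le> 1/2" using uU[OF i] U by (simp add: field_simps)
    then have "u i - 1/2 \<le> (1 - 1 / (2 * U)) * u i" by (simp add: left_diff_distrib)
    then show "(\<Sum>j<d. ((if i = j then 1 else 0) - R i j) * u j) \<le> (1 - 1 / (2 * U)) * u i"
      using Pu[OF i] unfolding P_def by linarith
  qed
qed

text \<open>The weights and the factor for the full matrix still work: leaving out the columns
  outside \<open>I\<close> only removes nonnegative terms from each row sum.\<close>

lemma skorokhod_problem_subset:
  assumes R: "reflection_nonsingular_M_matrix d R" and d: "1 \<le> d" and I: "I \<subseteq> {0..<d}"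
  obtains u \<theta> where "skorokhod_problem I R u \<theta>"
proof -
  obtain u \<theta> where u: "\<And>i. i < d \<Longrightarrow> 0 < u i" "0 \<le> \<theta>" "\<theta> < 1"
    "\<And>i. i < d \<Longrightarrow> (\<Sum>j<d. ((if i = j then 1 else 0) - R i j) * u j) \<le> \<theta> * u i"
    using reflection_M_matrix_weights[OF R d] by blast
  have "skorokhod_problem I R u \<theta>"
  proof
    show "finite I" using I finite_subset by blast
    show "R i i = 1" if "i \<in> I" for i using R I that by (auto simp: reflection_nonsingular_M_matrix_def)
    show off: "R i j \<le> 0" if "i \<in> I" "j \<in> I" "i \<noteq> j" for i j
      using R subsetD[OF I that(1)] subsetD[OF I that(2)] that(3) by (simp add: reflection_nonsingular_M_matrix_def)
    show "0 < u i" if "i \<in> I" for i using u(1) I that by auto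
    fix i assume i: "i \<in> I"
    have "(\<Sum>j\<in>I. ((if i = j then 1 else 0) - R i j) * u j) \<le> (\<Sum>j<d. ((if i = j then 1 else 0) - R i j) * u j)"
    proof (rule sum_mono2)
      fix j assume "j \<in> {..<d} - I"
      then show "0 \<le> ((if i = j then 1 else 0) - R i j) * u j"
        using R I i u(1)[of j] by (auto simp: reflection_nonsingular_M_matrix_def mult_nonpos_nonneg intro: less_imp_le)
    qed (use I in auto)
    also have "\<dots> \<le> \<theta> * u i" using u(4) I i by auto
    finally show "(\<Sum>j\<in>I. ((if i = j then 1 else 0) - R i j) * u j) \<le> \<theta> * u i" .
  qed (use u in auto)
  then show ?thesis by (rule that)
qed

section \<open>Independence of the future increments\<close>

text \<open>For finitely many times the claim follows by adding a new latest time and writing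
  \<open>W t\<close> as \<open>W s\<close> plus an increment independent of \<open>F s\<close>. The
  events depending on finitely many times form a pi-system, so independence extends to the
  sigma-algebra of the whole path.\<close>

lemma (in prob_space) independent_path_algebra:
  fixes W :: "real \<Rightarrow> 'a \<Rightarrow> nat \<Rightarrow> real" and F :: "real \<Rightarrow> 'a measure"
  assumes sub: "\<And>t. 0 \<le> t \<Longrightarrow> subalgebra M (F t)"
    and mono: "\<And>s t. 0 \<le> s \<Longrightarrow> s \<le> t \<Longrightarrow> sets (F s) \<subseteq> sets (F t)"
    and adapted: "\<And>t i. 0 \<le> t \<Longrightarrow> i \<in> I \<Longrightarrow> (\<lambda>\<omega>. W t \<omega> i) \<in> borel_measurable (F t)"
    and W0: "\<And>\<omega> i. \<omega> \<in> space M \<Longrightarrow> i \<in> I \<Longrightarrow> W 0 \<omega> i = 0"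
    and incr: "\<And>s t a E. 0 \<le> s \<Longrightarrow> s < t \<Longrightarrow> a \<in> sets (F s) \<Longrightarrow> E \<in> sets (PiM I (\<lambda>_. borel)) \<Longrightarrow>
      prob (a \<inter> {\<omega>\<in>space M. restrict (\<lambda>i. W t \<omega> i - W s \<omega> i) I \<in> E}) =
      prob a * prob {\<omega>\<in>space M. restrict (\<lambda>i. W t \<omega> i - W s \<omega> i) I \<in> E}"
  obtains G where "subalgebra M G" "\<And>t i. 0 \<le> t \<Longrightarrow> i \<in> I \<Longrightarrow> (\<lambda>\<omega>. W t \<omega> i) \<in> borel_measurable G"
    "indep_set (sets (F 0)) (sets G)"
proof -
  have sp: "space (F t) = space M" and sm: "sets (F t) \<subseteq> events" if "0 \<le> t" for t
    using sub[OF that] by (auto simp: subalgebra_def)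
  define gen where "gen T = {(\<lambda>\<omega>. W t \<omega> i) -` E \<inter> space M | t i E. t \<in> T \<and> i \<in> I \<and> E \<in> sets borel}" for T
  have gen_F: "sigma_sets (space M) (gen T) \<subseteq> sets (F s)" if T: "T \<subseteq> {0..s}" "0 \<le> s" for T s
  proof -
    have "gen T \<subseteq> sets (F s)"
    proof
      fix A assume "A \<in> gen T"
      then obtain t i E where A: "A = (\<lambda>\<omega>. W t \<omega> i) -` E \<inter> space M" "t \<in> T" "i \<in> I" "E \<in> sets borel"
        by (auto simp: gen_def)
      have t: "0 \<le> t" "t \<le> s" using A T by auto
      have "A \<in> sets (F t)"
        using measurable_sets[OF adapted[OF t(1) A(3)] A(4)] A(1) sp[OF t(1)] by simp
      then show "A \<in> sets (F s)" using mono[OF t] by auto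
    qed
    then show ?thesis using sets.sigma_sets_subset[of "gen T" "F s"] sp[OF T(2)] by simp
  qed
  have gen_pow: "gen T \<subseteq> Pow (space M)" for T by (auto simp: gen_def)
  have F0: "sigma_sets (space M) (sets (F 0)) = sets (F 0)"
    using sets.sigma_sets_eq[of "F 0"] sp[of 0] by simp
  have stF0: "Int_stable (sets (F 0))" by (auto simp: Int_stable_def)
  have fin: "indep_set (sets (F 0)) (sigma_sets (space M) (gen T))" if "finite T" "T \<subseteq> {0<..}" for T
    using that
  proof (induction T rule: finite_linorder_max_induct)
    case empty
    have "gen {} = {}" by (simp add: gen_def)
    then show ?case
      using sm[of 0] by (auto simp: indep_sets2_eq sigma_sets_empty_eq prob_space intro!: arg_cong[where f=prob] dest: sets.sets_into_space)
  next
    case (insert t T)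
    \<comment> \<open>The latest time before \<open>t\<close>. Including 0 covers an empty
      \<open>T\<close>; then \<open>W s = 0\<close> by \<open>W0\<close>, so measurability of
      \<open>W s\<close> is trivial.\<close>
    define s where "s = Max (insert 0 T)"
    have s_in: "s \<in> insert 0 T" unfolding s_def by (rule Max_in) (use insert in auto)
    have s_ge: "r \<le> s" if "r \<in> insert 0 T" for r
      unfolding s_def by (rule Max_ge) (use insert that in auto)
    have s: "0 \<le> s" "s < t" "T \<subseteq> {0..s}" "s \<in> insert 0 T"
      using s_in s_ge insert(2,4) by (auto intro: less_imp_le simp: subset_iff)
    define inc where "inc \<omega> = restrict (\<lambda>i. W t \<omega> i - W s \<omega> i) I" for \<omega>
    have inc_meas: "inc \<in> measurable M (PiM I (\<lambda>_. borel))"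
    proof -
      have "(\<lambda>\<omega>. W r \<omega> i) \<in> borel_measurable M" if "0 \<le> r" "i \<in> I" for r i
        by (rule measurable_from_subalg[OF sub[OF that(1)] adapted[OF that]])
      then show ?thesis unfolding inc_def using s
        by (intro measurable_restrict borel_measurable_diff) auto
    qed
    define Gs where "Gs = sigma_sets (space M) (gen T)"
    have GsF: "Gs \<subseteq> sets (F s)" unfolding Gs_def by (rule gen_F[OF s(3,1)])
    have Gs_Int: "a \<inter> b \<in> Gs" if "a \<in> Gs" "b \<in> Gs" for a b
      using sets.Int[of a "sigma (space M) (gen T)" b] that gen_pow[of T] by (simp add: Gs_def)
    \<comment> \<open>A pi-system of rectangles, past event times increment event; the sigma-algebra
      it generates makes \<open>W t\<close> measurable as well.\<close>
    define H where "H = {g \<inter> (inc -` E \<inter> space M) | g E. g \<in> Gs \<and> E \<in> sets (PiM I (\<lambda>_. borel))}"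
    have Hpow: "H \<subseteq> Pow (space M)" by (auto simp: H_def)
    have Hst: "Int_stable H"
    proof (rule Int_stableI)
      fix a b assume "a \<in> H" "b \<in> H"
      then obtain g E g' E' where "a = g \<inter> (inc -` E \<inter> space M)" "b = g' \<inter> (inc -` E' \<inter> space M)"
        "g \<in> Gs" "g' \<in> Gs" "E \<in> sets (PiM I (\<lambda>_. borel))" "E' \<in> sets (PiM I (\<lambda>_. borel))"
        by (auto simp: H_def)
      then show "a \<inter> b \<in> H"
        unfolding H_def by (intro CollectI exI[of _ "g \<inter> g'"] exI[of _ "E \<inter> E'"]) (auto intro: Gs_Int)
    qed
    have "indep_set (sets (F 0)) H"
      unfolding indep_sets2_eq
    proof (intro conjI ballI)
      show "sets (F 0) \<subseteq> events" by (rule sm) simp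
      show "H \<subseteq> events" using GsF sm[OF s(1)] measurable_sets[OF inc_meas] by (auto simp: H_def)
      fix a h assume a: "a \<in> sets (F 0)" and "h \<in> H"
      then obtain g E where h: "h = g \<inter> (inc -` E \<inter> space M)" and g: "g \<in> Gs" and E: "E \<in> sets (PiM I (\<lambda>_. borel))"
        by (auto simp: H_def)
      let ?V = "inc -` E \<inter> space M"
      have V: "prob (b \<inter> ?V) = prob b * prob ?V" if "b \<in> sets (F s)" for b
      proof -
        have "?V = {\<omega>\<in>space M. restrict (\<lambda>i. W t \<omega> i - W s \<omega> i) I \<in> E}" by (auto simp: inc_def)
        then show ?thesis using incr[OF s(1,2) that E] by simp
      qed
      have gF: "g \<in> sets (F s)" using g GsF by auto
      have aF: "a \<in> sets (F s)" using a mono[of 0 s] s by auto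
      \<comment> \<open>Both \<open>a \<inter> g\<close> and \<open>g\<close> lie in
        \<open>F s\<close>, so the increment is split off, the induction hypothesis separates
        \<open>a\<close> from \<open>g\<close>, and the increment is joined to \<open>g\<close>
        again.\<close>
      have "prob (a \<inter> h) = prob ((a \<inter> g) \<inter> ?V)" by (simp add: h Int_assoc)
      also have "\<dots> = prob (a \<inter> g) * prob ?V" by (rule V) (use aF gF in auto)
      also have "prob (a \<inter> g) = prob a * prob g"
        using insert.IH insert.prems a g by (auto simp: indep_sets2_eq Gs_def)
      also have "prob a * prob g * prob ?V = prob a * prob h" using V[OF gF] by (simp add: h)
      finally show "prob (a \<inter> h) = prob a * prob h" .
    qed
    then have ind: "indep_set (sets (F 0)) (sigma_sets (space M) H)"
      using indep_set_sigma_sets[OF _ stF0 Hst] F0 by simp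
    define N where "N = sigma (space M) H"
    have N: "space N = space M" "sets N = sigma_sets (space M) H"
      using Hpow by (auto simp: N_def)
    have inc_N: "inc \<in> measurable N (PiM I (\<lambda>_. borel))"
    proof (rule measurableI)
      show "inc \<omega> \<in> space (PiM I (\<lambda>_. borel))" for \<omega> by (auto simp: inc_def space_PiM)
      fix E assume "E \<in> sets (PiM I (\<lambda>_. borel :: real measure))"
      moreover have "space M \<in> Gs" unfolding Gs_def by (rule sigma_sets_top)
      ultimately have "inc -` E \<inter> space M \<in> H" unfolding H_def by blast
      then show "inc -` E \<inter> space N \<in> sets N" by (auto simp: N)
    qed
    have GsH: "Gs \<subseteq> H"
    proof
      fix g assume g: "g \<in> Gs"
      have "g = g \<inter> (inc -` space (PiM I (\<lambda>_. borel)) \<inter> space M)"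
        using g sigma_sets_into_sp[OF gen_pow, of g T] by (auto simp: Gs_def inc_def space_PiM)
      then show "g \<in> H" unfolding H_def using g by blast
    qed
    have WT: "(\<lambda>\<omega>. W r \<omega> i) \<in> borel_measurable N" if "r \<in> T" "i \<in> I" for r i
    proof (rule measurableI)
      fix E :: "real set" assume "E \<in> sets borel"
      then have "(\<lambda>\<omega>. W r \<omega> i) -` E \<inter> space M \<in> Gs"
        unfolding Gs_def using that by (intro sigma_sets.Basic) (auto simp: gen_def)
      then show "(\<lambda>\<omega>. W r \<omega> i) -` E \<inter> space N \<in> sets N" using GsH by (auto simp: N)
    qed auto
    have Ws: "(\<lambda>\<omega>. W s \<omega> i) \<in> borel_measurable N" if i: "i \<in> I" for i
    proof (cases "s \<in> T")
      case False
      then have "s = 0" using s by auto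
      then have "(\<lambda>\<omega>. W s \<omega> i) \<in> borel_measurable N \<longleftrightarrow> (\<lambda>\<omega>. 0 :: real) \<in> borel_measurable N"
        using W0 i by (intro measurable_cong) (auto simp: N)
      then show ?thesis by simp
    qed (rule WT[OF _ i])
    have Wt: "(\<lambda>\<omega>. W t \<omega> i) \<in> borel_measurable N" if i: "i \<in> I" for i
    proof -
      have "(\<lambda>\<omega>. inc \<omega> i) \<in> borel_measurable N"
        by (rule measurable_compose[OF inc_N measurable_component_singleton[OF i]])
      then have "(\<lambda>\<omega>. W s \<omega> i + inc \<omega> i) \<in> borel_measurable N" by (intro borel_measurable_add Ws i)
      then show ?thesis using i by (simp add: inc_def)
    qed
    have "gen (insert t T) \<subseteq> sets N"
    proof
      fix A assume "A \<in> gen (insert t T)"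
      then obtain r i E where A: "A = (\<lambda>\<omega>. W r \<omega> i) -` E \<inter> space M" "r \<in> insert t T" "i \<in> I" "E \<in> sets borel"
        by (auto simp: gen_def)
      have "(\<lambda>\<omega>. W r \<omega> i) \<in> borel_measurable N" using A(2) WT[OF _ A(3)] Wt[OF A(3)] by auto
      from measurable_sets[OF this A(4)] show "A \<in> sets N" unfolding A(1) N(1) .
    qed
    then have "sigma_sets (space M) (gen (insert t T)) \<subseteq> sigma_sets (space M) H"
      using sets.sigma_sets_subset[of "gen (insert t T)" N] N by simp
    then show ?case using ind by (auto simp: indep_sets2_eq)
  qed
  define Pi where "Pi = (\<Union>T\<in>{T. finite T \<and> T \<subseteq> {0<..}}. sigma_sets (space M) (gen T))"
  have Pipow: "Pi \<subseteq> Pow (space M)" using sigma_sets_into_sp[OF gen_pow] by (auto simp: Pi_def)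
  have gm: "sigma_sets (space M) (gen T) \<subseteq> sigma_sets (space M) (gen T')" if "T \<subseteq> T'" for T T'
    by (rule sigma_sets_subseteq) (use that in \<open>auto simp: gen_def\<close>)
  have Pist: "Int_stable Pi"
  proof (rule Int_stableI)
    fix a b assume "a \<in> Pi" "b \<in> Pi"
    then obtain T T' where T: "finite T" "T \<subseteq> {0<..}" "finite T'" "T' \<subseteq> {0<..}"
      "a \<in> sigma_sets (space M) (gen T)" "b \<in> sigma_sets (space M) (gen T')" by (auto simp: Pi_def)
    have "a \<inter> b \<in> sigma_sets (space M) (gen (T \<union> T'))"
      using T gm[of T "T \<union> T'"] gm[of T' "T \<union> T'"] sets.Int[of a "sigma (space M) (gen (T \<union> T'))" b]
        gen_pow[of "T \<union> T'"] by auto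
    then show "a \<inter> b \<in> Pi" using T by (auto simp: Pi_def)
  qed
  have "indep_set (sets (F 0)) Pi"
    unfolding indep_sets2_eq
  proof (intro conjI ballI)
    show "sets (F 0) \<subseteq> events" by (rule sm) simp
    show "Pi \<subseteq> events" using fin by (auto simp: Pi_def indep_sets2_eq)
    show "prob (a \<inter> b) = prob a * prob b" if "a \<in> sets (F 0)" "b \<in> Pi" for a b
      using fin that by (auto simp: Pi_def indep_sets2_eq)
  qed
  then have ind: "indep_set (sets (F 0)) (sigma_sets (space M) Pi)"
    using indep_set_sigma_sets[OF _ stF0 Pist] F0 by simp
  define G where "G = sigma (space M) Pi"
  have G: "space G = space M" "sets G = sigma_sets (space M) Pi" using Pipow by (auto simp: G_def)
  show ?thesis
  proof (rule that[of G])
    show "indep_set (sets (F 0)) (sets G)" using ind G by simp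
    then show "subalgebra M G" using G by (auto simp: subalgebra_def indep_sets2_eq)
    fix t :: real and i assume t: "0 \<le> t" and i: "i \<in> I"
    show "(\<lambda>\<omega>. W t \<omega> i) \<in> borel_measurable G"
    proof (cases "t = 0")
      case True
      then have "(\<lambda>\<omega>. W t \<omega> i) \<in> borel_measurable G \<longleftrightarrow> (\<lambda>\<omega>. 0 :: real) \<in> borel_measurable G"
        using W0 i by (intro measurable_cong) (auto simp: G)
      then show ?thesis by simp
    next
      case False
      show ?thesis
      proof (rule measurableI)
        fix E :: "real set" assume "E \<in> sets borel"
        then have "(\<lambda>\<omega>. W t \<omega> i) -` E \<inter> space M \<in> sigma_sets (space M) (gen {t})"
          using i by (intro sigma_sets.Basic) (auto simp: gen_def)
        then have "(\<lambda>\<omega>. W t \<omega> i) -` E \<inter> space M \<in> Pi"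
          using t False by (auto simp: Pi_def intro!: exI[of _ "{t}"])
        then show "(\<lambda>\<omega>. W t \<omega> i) -` E \<inter> space G \<in> sets G" by (auto simp: G)
      qed auto
    qed
  qed
qed

text \<open>By independence the law of \<open>(x, x)\<close> on \<open>S \<Otimes>\<^sub>M T\<close>
  is the product of the two marginals; a statement valid for almost every second argument at each
  fixed first one holds almost surely under the product by Fubini, hence along the diagonal.\<close>

lemma (in prob_space) AE_independent_diagonal:
  assumes S: "subalgebra M S" and T: "subalgebra M T" and ind: "indep_set (sets S) (sets T)"
    and meas: "{p \<in> space (S \<Otimes>\<^sub>M T). P (fst p) (snd p)} \<in> sets (S \<Otimes>\<^sub>M T)"
    and AE: "\<And>x. x \<in> space M \<Longrightarrow> AE y in M. P x y"
  shows "AE x in M. P x x"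
proof -
  have idS: "(\<lambda>x. x) \<in> measurable M S" and idT: "(\<lambda>x. x) \<in> measurable M T"
    using S T by (auto simp: subalgebra_def measurable_def dest: sets.sets_into_space)
  have spS: "space S = space M" and spT: "space T = space M" using S T by (auto simp: subalgebra_def)
  have sg: "sigma_sets (space M) {(\<lambda>x. x) -` A \<inter> space M |A. A \<in> sets N} = sets N" if "space N = space M" for N
  proof -
    have "{(\<lambda>x. x) -` A \<inter> space M |A. A \<in> sets N} = sets N"
      using that sets.sets_into_space[of _ N] by (auto simp: Int_absorb2)
    then show ?thesis using sets.sigma_sets_eq[of N] that by simp
  qed
  have "indep_var S (\<lambda>x. x) T (\<lambda>x. x)"
    unfolding indep_var_eq using idS idT ind sg[OF spS] sg[OF spT] by simp
  then have eq: "distr M S (\<lambda>x. x) \<Otimes>\<^sub>M distr M T (\<lambda>x. x) = distr M (S \<Otimes>\<^sub>M T) (\<lambda>x. (x, x))"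
    by (simp add: indep_var_distribution_eq)
  interpret S: prob_space "distr M S (\<lambda>x. x)" by (rule prob_space_distr[OF idS])
  interpret T: prob_space "distr M T (\<lambda>x. x)" by (rule prob_space_distr[OF idT])
  interpret ST: pair_prob_space "distr M S (\<lambda>x. x)" "distr M T (\<lambda>x. x)" ..
  have meas_T: "{y \<in> space T. P x y} \<in> sets T" if "x \<in> space M" for x
    using measurable_sets[OF measurable_Pair1'[of x S T] meas] that spS
    by (auto simp: space_pair_measure vimage_def Int_def conj_commute cong: conj_cong)
  have "AE p in distr M S (\<lambda>x. x) \<Otimes>\<^sub>M distr M T (\<lambda>x. x). P (fst p) (snd p)"
  proof (rule ST.AE_pair_measure)
    show "{p \<in> space (distr M S (\<lambda>x. x) \<Otimes>\<^sub>M distr M T (\<lambda>x. x)). P (fst p) (snd p)}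
      \<in> sets (distr M S (\<lambda>x. x) \<Otimes>\<^sub>M distr M T (\<lambda>x. x))"
      using meas by (simp add: space_pair_measure cong: sets_pair_measure_cong)
    have "AE y in distr M T (\<lambda>x. x). P x y" if "x \<in> space M" for x
      using AE[OF that] AE_distr_iff[OF idT meas_T[OF that]] by simp
    then show "AE x in distr M S (\<lambda>x. x). AE y in distr M T (\<lambda>x. x). P (fst (x, y)) (snd (x, y))"
      by (intro AE_I2[of "distr M S (\<lambda>x. x)"]) (simp add: spS)
  qed
  then have "AE p in distr M (S \<Otimes>\<^sub>M T) (\<lambda>x. (x, x)). P (fst p) (snd p)" by (simp only: eq)
  then show ?thesis
    by (subst (asm) AE_distr_iff) (use meas idS idT in \<open>auto intro!: measurable_Pair\<close>)
qed

section \<open>Restarting the process\<close>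

lemma filtration_onD:
  assumes "filtration_on M F"
  shows "space (F t) = space M" "sets (F t) \<subseteq> sets M" "s \<le> t \<Longrightarrow> sets (F s) \<subseteq> sets (F t)" "subalgebra M (F t)"
  using assms by (auto simp: filtration_on_def filtration_def subalgebra_def)

lemma filtration_on_shift: "filtration_on M F \<Longrightarrow> filtration_on M (\<lambda>t. F (q + t))"
  by (auto simp: filtration_on_def filtration_def)

lemma filtration_on_measurable_mono:
  assumes "filtration_on M F" "s \<le> t" "f \<in> measurable (F s) N"
  shows "f \<in> measurable (F t) N"
  using measurable_mono[of N N "F s" "F t"] filtration_onD[OF assms(1)] assms(2,3) by auto

lemma brownian_motion_on_restart:
  assumes B: "brownian_motion_on D M F \<mu> A z B" and F: "filtration_on M F"
    and D: "finite D" "I \<subseteq> D" and q: "0 \<le> q"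
  shows "brownian_motion_on I M (\<lambda>t. F (q + t)) \<mu> A x (\<lambda>t \<omega> i. x i + (B (q + t) \<omega> i - B q \<omega> i))"
  unfolding brownian_motion_on_def
proof (intro conjI allI impI ballI)
  show "adapted_on I (\<lambda>t. F (q + t)) (\<lambda>t \<omega> i. x i + (B (q + t) \<omega> i - B q \<omega> i))"
    unfolding adapted_on_def
  proof (intro allI impI ballI)
    fix t :: real and i assume t: "0 \<le> t" and i: "i \<in> I"
    have "(\<lambda>\<omega>. B s \<omega> i) \<in> borel_measurable (F (q + t))" if "0 \<le> s" "s \<le> q + t" for s
      by (rule filtration_on_measurable_mono[OF F that(2)])
        (use B that i D in \<open>auto simp: brownian_motion_on_def adapted_on_def\<close>)
    then show "(\<lambda>\<omega>. x i + (B (q + t) \<omega> i - B q \<omega> i)) \<in> borel_measurable (F (q + t))"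
      using q t by (intro borel_measurable_add borel_measurable_diff) auto
  qed
  show "continuous_paths_on I M (\<lambda>t \<omega> i. x i + (B (q + t) \<omega> i - B q \<omega> i))"
    unfolding continuous_paths_on_def
  proof (intro ballI)
    fix \<omega> i assume \<omega>: "\<omega> \<in> space M" and i: "i \<in> I"
    have "continuous_on {0..} (\<lambda>t. B t \<omega> i)"
      using B \<omega> i D by (auto simp: brownian_motion_on_def continuous_paths_on_def)
    then have "continuous_on {0..} (\<lambda>t. B (q + t) \<omega> i)"
      by (rule continuous_on_compose2) (use q in \<open>auto intro!: continuous_intros\<close>)
    then show "continuous_on {0..} (\<lambda>t. x i + (B (q + t) \<omega> i - B q \<omega> i))" by (intro continuous_intros)
  qed
next
  fix s t :: real assume st: "0 \<le> s" "s < t"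
  then have qst: "0 \<le> q + s" "q + s < q + t" using q by auto
  show "measure M (a \<inter> {\<omega>\<in>space M. restrict (\<lambda>i. x i + (B (q + t) \<omega> i - B q \<omega> i) - (x i + (B (q + s) \<omega> i - B q \<omega> i))) I \<in> E}) =
      measure M a * measure M {\<omega>\<in>space M. restrict (\<lambda>i. x i + (B (q + t) \<omega> i - B q \<omega> i) - (x i + (B (q + s) \<omega> i - B q \<omega> i))) I \<in> E}"
    if a: "a \<in> sets (F (q + s))" and E: "E \<in> sets (PiM I (\<lambda>_. borel))" for a E
  proof -
    \<comment> \<open>Independence is known for increments indexed by \<open>D\<close>, so the event
      on \<open>I\<close> is pulled back along restriction of coordinates.\<close>
    define E' where "E' = (\<lambda>f. restrict f I) -` E \<inter> space (PiM D (\<lambda>_. borel :: real measure))"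
    have E': "E' \<in> sets (PiM D (\<lambda>_. borel))"
      unfolding E'_def by (rule measurable_sets[OF measurable_restrict_subset[OF D(2)] E])
    have eq: "{\<omega>\<in>space M. restrict (\<lambda>i. x i + (B (q + t) \<omega> i - B q \<omega> i) - (x i + (B (q + s) \<omega> i - B q \<omega> i))) I \<in> E}
      = {\<omega>\<in>space M. restrict (\<lambda>i. B (q + t) \<omega> i - B (q + s) \<omega> i) D \<in> E'}"
      using D(2) by (simp add: E'_def space_PiM Int_absorb1)
    show ?thesis unfolding eq using B a E' qst by (auto simp: brownian_motion_on_def)
  qed
  show "distributed M lborel (\<lambda>\<omega>. \<Sum>i\<in>I. u i * (x i + (B (q + t) \<omega> i - B q \<omega> i) - (x i + (B (q + s) \<omega> i - B q \<omega> i))))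
      (normal_density ((t - s) * (\<Sum>i\<in>I. u i * \<mu> i)) (sqrt ((t - s) * (\<Sum>i\<in>I. \<Sum>j\<in>I. u i * A i j * u j))))"
    if u: "\<exists>i\<in>I. u i \<noteq> 0" for u :: "nat \<Rightarrow> real"
  proof -
    \<comment> \<open>Extension by zero turns a linear functional of the
      \<open>I\<close>-coordinates into one of all coordinates with the same mean and
      variance.\<close>
    define v where "v i = (if i \<in> I then u i else 0)" for i
    have sum_v: "(\<Sum>i\<in>D. v i * f i) = (\<Sum>i\<in>I. u i * f i)" for f :: "nat \<Rightarrow> real"
      by (rule sum.mono_neutral_cong_right) (use D in \<open>auto simp: v_def\<close>)
    have sum_A: "(\<Sum>i\<in>D. \<Sum>j\<in>D. v i * A i j * v j) = (\<Sum>i\<in>I. \<Sum>j\<in>I. u i * A i j * u j)"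
    proof -
      have "(\<Sum>i\<in>D. \<Sum>j\<in>D. v i * A i j * v j) = (\<Sum>i\<in>D. v i * (\<Sum>j\<in>D. v j * A i j))"
        by (simp add: sum_distrib_left mult_ac)
      also have "\<dots> = (\<Sum>i\<in>I. u i * (\<Sum>j\<in>I. u j * A i j))" by (simp only: sum_v)
      finally show ?thesis by (simp add: sum_distrib_left mult_ac)
    qed
    have ex: "\<exists>i\<in>D. v i \<noteq> 0" using u D by (auto simp: v_def)
    have "distributed M lborel (\<lambda>\<omega>. \<Sum>i\<in>D. v i * (B (q + t) \<omega> i - B (q + s) \<omega> i))
      (normal_density ((q + t - (q + s)) * (\<Sum>i\<in>D. v i * \<mu> i)) (sqrt ((q + t - (q + s)) * (\<Sum>i\<in>D. \<Sum>j\<in>D. v i * A i j * v j))))"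
      using B qst ex unfolding brownian_motion_on_def by blast
    then show ?thesis by (simp add: sum_v sum_A)
  qed
qed simp

context skorokhod_problem
begin

text \<open>Existence of the process on the given filtered space, which the non-hitting hypothesis
  needs in order to be instantiated. Adaptedness holds because the regulator at \<open>t\<close>
  depends on the driving path only up to \<open>t\<close>.\<close>

lemma srbm_on_regulator:
  assumes M: "prob_space M" and F: "filtration_on M F" and B: "brownian_motion_on I M F \<mu> A x B"
    and x: "\<And>i. i \<in> I \<Longrightarrow> 0 \<le> x i"
  shows "srbm_on I R \<mu> A x M F
    (\<lambda>t \<omega> i. B t \<omega> i + (\<Sum>j\<in>I. R i j * regulator (\<lambda>s. B s \<omega>) t j)) B (\<lambda>t \<omega>. regulator (\<lambda>s. B s \<omega>) t)"
proof -
  have Bc: "continuous_on {0..} (\<lambda>t. B t \<omega> i)" if "\<omega> \<in> space M" "i \<in> I" for \<omega> i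
    using B that by (auto simp: brownian_motion_on_def continuous_paths_on_def)
  have Bm: "(\<lambda>\<omega>. B s \<omega> i) \<in> borel_measurable (F t)" if "0 \<le> s" "s \<le> t" "i \<in> I" for s t i
    by (rule filtration_on_measurable_mono[OF F that(2)])
      (use B that in \<open>auto simp: brownian_motion_on_def adapted_on_def\<close>)
  have Lm: "(\<lambda>\<omega>. regulator (\<lambda>s. B s \<omega>) t i) \<in> borel_measurable (F t)" if "0 \<le> t" "i \<in> I" for t i
    by (rule regulator_measurable)
      (use Bm that in \<open>auto simp: filtration_onD[OF F] intro: continuous_on_subset[OF Bc]\<close>)
  have Lc: "continuous_on {0..} (\<lambda>t. regulator (\<lambda>s. B s \<omega>) t i)" if "\<omega> \<in> space M" "i \<in> I" for \<omega> i
    by (rule regulator_continuous) (use Bc that in auto)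
  have Zc: "continuous_on {0..} (\<lambda>t. B t \<omega> i + (\<Sum>j\<in>I. R i j * regulator (\<lambda>s. B s \<omega>) t j))"
    if "\<omega> \<in> space M" "i \<in> I" for \<omega> i
    using Bc Lc that by (intro continuous_intros) auto
  have mono: "mono_on {0..} (\<lambda>t. regulator (\<lambda>s. B s \<omega>) t i)" if "\<omega> \<in> space M" "i \<in> I" for \<omega> i
    by (rule regulator_mono) (use Bc that in auto)
  show ?thesis
    unfolding srbm_on_def
  proof (intro conjI ballI allI impI)
    show "adapted_on I F (\<lambda>t \<omega> i. B t \<omega> i + (\<Sum>j\<in>I. R i j * regulator (\<lambda>s. B s \<omega>) t j))"
      unfolding adapted_on_def using Bm Lm by auto
    show "adapted_on I F (\<lambda>t \<omega>. regulator (\<lambda>s. B s \<omega>) t)" using Lm by (auto simp: adapted_on_def)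
    show "continuous_paths_on I M (\<lambda>t \<omega> i. B t \<omega> i + (\<Sum>j\<in>I. R i j * regulator (\<lambda>s. B s \<omega>) t j))"
      using Zc by (auto simp: continuous_paths_on_def)
    show "continuous_paths_on I M (\<lambda>t \<omega>. regulator (\<lambda>s. B s \<omega>) t)" using Lc by (auto simp: continuous_paths_on_def)
    show "regulator (\<lambda>s. B s \<omega>) 0 k = 0" if "\<omega> \<in> space M" "k \<in> I" for \<omega> k
      by (rule regulator_zero) (use B x that in \<open>auto simp: brownian_motion_on_def\<close>)
    show "0 \<le> B t \<omega> i + (\<Sum>j\<in>I. R i j * regulator (\<lambda>s. B s \<omega>) t j)" if "\<omega> \<in> space M" "0 \<le> t" "i \<in> I" for \<omega> t i
      by (rule reflected_nonneg) (use Bc that in auto)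
    show "(\<integral>\<^sup>+ t. ennreal (B t \<omega> k + (\<Sum>j\<in>I. R k j * regulator (\<lambda>s. B s \<omega>) t j))
        \<partial>interval_measure (\<lambda>t. regulator (\<lambda>s. B s \<omega>) (max 0 t) k)) = 0"
      if "\<omega> \<in> space M" "k \<in> I" for \<omega> k
    proof (rule complementarity_of_flat[OF Lc[OF that] mono[OF that] Zc[OF that]])
      fix a b assume "0 \<le> a" "a \<le> b" "\<And>s. a \<le> s \<Longrightarrow> s \<le> b \<Longrightarrow> 0 < B s \<omega> k + (\<Sum>j\<in>I. R k j * regulator (\<lambda>s. B s \<omega>) s j)"
      then show "regulator (\<lambda>s. B s \<omega>) a k = regulator (\<lambda>s. B s \<omega>) b k"
        using that Bc by (intro regulator_flat) auto
    qed
  qed (use M F B mono in auto)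
qed

text \<open>The non-hitting hypothesis concerns deterministic starting points only, whereas the
  restarted process begins at the random point \<open>Z q\<close>. As the future increments are independent of
  \<open>F q\<close>, the point may be frozen by Fubini's theorem.\<close>

lemma restart_not_hit:
  fixes M :: "'w measure"
  assumes srbm: "srbm_on D R \<mu> A z M F Z B L" and D: "finite D" "I \<subseteq> D" and q: "0 \<le> q"
    and nohit: "srbm_not_hit TYPE('w) I R \<mu> A I"
  defines "X \<equiv> \<lambda>t \<omega> i. Z q \<omega> i + (B (q + t) \<omega> i - B q \<omega> i)"
  shows "AE \<omega> in M. \<not> (\<exists>t>0. \<forall>i\<in>I. X t \<omega> i + (\<Sum>j\<in>I. R i j * regulator (\<lambda>s. X s \<omega>) t j) = 0)"
proof -
  have M: "prob_space M" and F: "filtration_on M F" and B: "brownian_motion_on D M F \<mu> A z B"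
    using srbm by (auto simp: srbm_on_def)
  interpret prob_space M by (rule M)
  have Zq: "0 \<le> Z q \<omega> i" if "\<omega> \<in> space M" "i \<in> I" for \<omega> i
    using srbm that D q by (auto simp: srbm_on_def)
  have Zm: "(\<lambda>\<omega>. Z q \<omega> i) \<in> borel_measurable (F q)" if "i \<in> I" for i
    using srbm that D q by (auto simp: srbm_on_def adapted_on_def)
  define W where "W t \<omega> i = B (q + t) \<omega> i - B q \<omega> i" for t \<omega> i
  have BW: "brownian_motion_on I M (\<lambda>t. F (q + t)) \<mu> A x (\<lambda>t \<omega> i. x i + W t \<omega> i)" for x
    unfolding W_def by (rule brownian_motion_on_restart[OF B F D q])
  have BW0: "brownian_motion_on I M (\<lambda>t. F (q + t)) \<mu> A (\<lambda>_. 0) W" using BW[of "\<lambda>_. 0"] by simp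
  have Wc: "continuous_on {0..} (\<lambda>t. W t \<omega> i)" if "\<omega> \<in> space M" "i \<in> I" for \<omega> i
    using BW0 that by (auto simp: brownian_motion_on_def continuous_paths_on_def)
  obtain G where G: "subalgebra M G" "\<And>t i. 0 \<le> t \<Longrightarrow> i \<in> I \<Longrightarrow> (\<lambda>\<omega>. W t \<omega> i) \<in> borel_measurable G"
    "indep_set (sets (F (q + 0))) (sets G)"
  proof (rule independent_path_algebra[of "\<lambda>t. F (q + t)" I W])
    show "subalgebra M (F (q + t))" for t by (rule filtration_onD[OF F])
    show "sets (F (q + s)) \<subseteq> sets (F (q + t))" if "s \<le> t" for s t
      by (rule filtration_onD(3)[OF F]) (use that in simp)
  qed (use BW0 in \<open>auto simp: brownian_motion_on_def adapted_on_def\<close>)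
  \<comment> \<open>On the product space the first component supplies the starting point and the
    second one the noise; the diagonal recovers \<open>X\<close>.\<close>
  define Y where "Y t p i = Z q (fst p) i + W t (snd p) i" for t i and p :: "'w \<times> 'w"
  \<comment> \<open>All summands are nonnegative, so reaching the corner becomes a zero of one real
    continuous process.\<close>
  define V where "V t p = (\<Sum>i\<in>I. Y t p i + (\<Sum>j\<in>I. R i j * regulator (\<lambda>s. Y s p) t j))" for t p
  have V0: "V t p = 0 \<longleftrightarrow> (\<forall>i\<in>I. Y t p i + (\<Sum>j\<in>I. R i j * regulator (\<lambda>s. Y s p) t j) = 0)"
    if "snd p \<in> space M" "0 \<le> t" for t p
    unfolding V_def
  proof (rule sum_nonneg_eq_0_iff[OF finite_I])
    show "0 \<le> Y t p i + (\<Sum>j\<in>I. R i j * regulator (\<lambda>s. Y s p) t j)" if "i \<in> I" for i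
      by (rule reflected_nonneg)
        (use \<open>snd p \<in> space M\<close> \<open>0 \<le> t\<close> that Wc in \<open>auto simp: Y_def intro!: continuous_intros\<close>)
  qed
  let ?N = "F (q + 0) \<Otimes>\<^sub>M G"
  have sp: "fst p \<in> space M" "snd p \<in> space M" if "p \<in> space ?N" for p
    using that G(1) by (auto simp: space_pair_measure subalgebra_def filtration_onD[OF F])
  have Ym: "(\<lambda>p. Y t p i) \<in> borel_measurable ?N" if "0 \<le> t" "i \<in> I" for t i
    unfolding Y_def
    using measurable_compose[OF measurable_fst, of "\<lambda>\<omega>. Z q \<omega> i" "F (q + 0)" borel G]
      measurable_compose[OF measurable_snd, of "\<lambda>\<omega>. W t \<omega> i" G borel "F (q + 0)"] Zm G(2) that
    by (intro borel_measurable_add) auto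
  have Yc: "continuous_on {0..} (\<lambda>t. Y t p i)" if "snd p \<in> space M" "i \<in> I" for p i
    unfolding Y_def by (intro continuous_intros Wc that)
  have Vm: "V t \<in> borel_measurable ?N" if t: "0 \<le> t" for t
  proof -
    have "(\<lambda>p. regulator (\<lambda>s. Y s p) t j) \<in> borel_measurable ?N" if "j \<in> I" for j
      by (rule regulator_measurable) (use Ym sp t that in \<open>auto intro: continuous_on_subset[OF Yc]\<close>)
    then show ?thesis unfolding V_def[abs_def] using Ym t
      by (intro borel_measurable_sum borel_measurable_add borel_measurable_times) auto
  qed
  have Vc: "continuous_on {0..} (\<lambda>t. V t p)" if "snd p \<in> space M" for p
    unfolding V_def using Yc that regulator_continuous[OF Yc]
    by (intro continuous_intros) auto
  have hit: "{p \<in> space ?N. \<exists>t>0. V t p = 0} \<in> sets ?N"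
    by (rule hits_zero_measurable) (use Vm Vc sp in auto)
  have "AE \<omega> in M. \<not> (\<exists>t>0. V t (\<omega>, \<omega>) = 0)"
  proof (rule AE_independent_diagonal[OF filtration_onD(4)[OF F] G(1,3), where P="\<lambda>\<omega> \<omega>'. \<not> (\<exists>t>0. V t (\<omega>, \<omega>') = 0)"])
    show "{p \<in> space ?N. \<not> (\<exists>t>0. V t (fst p, snd p) = 0)} \<in> sets ?N"
      using sets.sets_Collect_neg[OF hit] by simp
    fix \<omega> assume \<omega>: "\<omega> \<in> space M"
    define Bx where "Bx t \<omega>' i = Z q \<omega> i + W t \<omega>' i" for t \<omega>' i
    have "srbm_on I R \<mu> A (Z q \<omega>) M (\<lambda>t. F (q + t))
      (\<lambda>t \<omega>' i. Bx t \<omega>' i + (\<Sum>j\<in>I. R i j * regulator (\<lambda>s. Bx s \<omega>') t j)) Bx (\<lambda>t \<omega>'. regulator (\<lambda>s. Bx s \<omega>') t)"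
      by (rule srbm_on_regulator[OF M filtration_on_shift[OF F]])
        (use BW[of "Z q \<omega>"] Zq[OF \<omega>] in \<open>auto simp: Bx_def[abs_def]\<close>)
    then have "AE \<omega>' in M. \<forall>t>0. \<not> (\<forall>j\<in>I. Bx t \<omega>' j + (\<Sum>k\<in>I. R j k * regulator (\<lambda>s. Bx s \<omega>') t k) = 0)"
      using nohit Zq[OF \<omega>] unfolding srbm_not_hit_def by blast
    then show "AE \<omega>' in M. \<not> (\<exists>t>0. V t (\<omega>, \<omega>') = 0)"
    proof (rule AE_mp, intro AE_I2 impI)
      fix \<omega>' assume \<omega>': "\<omega>' \<in> space M"
        and no: "\<forall>t>0. \<not> (\<forall>j\<in>I. Bx t \<omega>' j + (\<Sum>k\<in>I. R j k * regulator (\<lambda>s. Bx s \<omega>') t k) = 0)"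
      have "Y t (\<omega>, \<omega>') = Bx t \<omega>'" for t by (auto simp: Y_def Bx_def)
      then show "\<not> (\<exists>t>0. V t (\<omega>, \<omega>') = 0)" using no V0[of "(\<omega>, \<omega>')"] \<omega>' by auto
    qed
  qed
  then show ?thesis
  proof (rule AE_mp, intro AE_I2 impI)
    fix \<omega> assume \<omega>: "\<omega> \<in> space M" and no: "\<not> (\<exists>t>0. V t (\<omega>, \<omega>) = 0)"
    have "Y t (\<omega>, \<omega>) = X t \<omega>" for t by (auto simp: Y_def X_def W_def)
    then show "\<not> (\<exists>t>0. \<forall>i\<in>I. X t \<omega> i + (\<Sum>j\<in>I. R i j * regulator (\<lambda>s. X s \<omega>) t j) = 0)"
      using no V0[of "(\<omega>, \<omega>)"] \<omega> by auto
  qed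
qed

text \<open>Purely pathwise, for one \<open>\<omega>\<close> and only up to time \<open>r\<close>.
  The coordinates in \<open>I\<close> may touch 0 freely, since their reflection is reproduced by
  the regulator.\<close>

lemma reflected_path_eq:
  assumes srbm: "srbm_on D R \<mu> A z M F Z B L" and D: "finite D" "I \<subseteq> D" and q: "0 \<le> q"
    and \<omega>: "\<omega> \<in> space M"
    and pos: "\<And>i s. i \<in> D - I \<Longrightarrow> q \<le> s \<Longrightarrow> s \<le> r \<Longrightarrow> 0 < Z s \<omega> i"
    and t: "0 \<le> t" "q + t \<le> r" and i: "i \<in> I"
  defines "X \<equiv> \<lambda>t i. Z q \<omega> i + (B (q + t) \<omega> i - B q \<omega> i)"
  shows "X t i + (\<Sum>j\<in>I. R i j * regulator X t j) = Z (q + t) \<omega> i"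
proof -
  have Lc: "continuous_on {0..} (\<lambda>t. L t \<omega> i)" and Zc: "continuous_on {0..} (\<lambda>t. Z t \<omega> i)"
    and Lm: "mono_on {0..} (\<lambda>t. L t \<omega> i)"
    and int: "(\<integral>\<^sup>+ t. ennreal (Z t \<omega> i) \<partial>(interval_measure (\<lambda>t. L (max 0 t) \<omega> i))) = 0"
    if "i \<in> D" for i
    using srbm \<omega> that by (auto simp: srbm_on_def continuous_paths_on_def)
  have Bc: "continuous_on {0..} (\<lambda>t. B t \<omega> i)" if "i \<in> D" for i
    using srbm \<omega> that by (auto simp: srbm_on_def brownian_motion_on_def continuous_paths_on_def)
  have Zeq: "Z t \<omega> i = B t \<omega> i + (\<Sum>j\<in>D. R i j * L t \<omega> j)" if "0 \<le> t" "i \<in> D" for t i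
    using srbm \<omega> that by (auto simp: srbm_on_def)
  have Znn: "0 \<le> Z t \<omega> i" if "0 \<le> t" "i \<in> D" for t i
    using srbm \<omega> that by (auto simp: srbm_on_def)
  have flat: "L a \<omega> i = L b \<omega> i"
    if "i \<in> D" "0 \<le> a" "a \<le> b" "\<And>s. a \<le> s \<Longrightarrow> s \<le> b \<Longrightarrow> 0 < Z s \<omega> i" for i a b
    by (rule flat_of_complementarity[OF Lc[OF that(1)] Lm[OF that(1)] Zc[OF that(1)] int[OF that(1)]]) (use that in auto)
  define K where "K s i = L (q + s) \<omega> i - L q \<omega> i" for s i
  have K0: "K s j = 0" if "j \<in> D - I" "0 \<le> s" "q + s \<le> r" for s j
  proof -
    have "L q \<omega> j = L (q + s) \<omega> j"
    proof (rule flat)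
      show "0 < Z a \<omega> j" if "q \<le> a" "a \<le> q + s" for a
        by (rule pos) (use that \<open>j \<in> D - I\<close> \<open>q + s \<le> r\<close> in auto)
    qed (use that q in auto)
    then show ?thesis by (simp add: K_def)
  qed
  \<comment> \<open>By \<open>K0\<close> the sum over \<open>I\<close> may be extended to
    \<open>D\<close>; the rest is the difference of the equations for \<open>Z\<close> at
    \<open>q + s\<close> and at \<open>q\<close>.\<close>
  have XK: "X s i + (\<Sum>j\<in>I. R i j * K s j) = Z (q + s) \<omega> i" if "0 \<le> s" "q + s \<le> r" "i \<in> I" for s i
  proof -
    have "(\<Sum>j\<in>I. R i j * K s j) = (\<Sum>j\<in>D. R i j * K s j)"
    proof (rule sum.mono_neutral_left[OF D], rule ballI)
      show "R i j * K s j = 0" if "j \<in> D - I" for j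
        using K0[OF that \<open>0 \<le> s\<close> \<open>q + s \<le> r\<close>] by simp
    qed
    also have "\<dots> = (\<Sum>j\<in>D. R i j * L (q + s) \<omega> j) - (\<Sum>j\<in>D. R i j * L q \<omega> j)"
      by (simp add: K_def right_diff_distrib sum_subtractf)
    finally have "(\<Sum>j\<in>I. R i j * K s j) = (\<Sum>j\<in>D. R i j * L (q + s) \<omega> j) - (\<Sum>j\<in>D. R i j * L q \<omega> j)" .
    moreover have "0 \<le> q + s" "i \<in> D" using that q D by auto
    ultimately show ?thesis using Zeq[of "q + s" i] Zeq[OF q, of i] by (simp add: X_def)
  qed
  have shift: "continuous_on {0..} (\<lambda>t. f (q + t))" if "continuous_on {0..} f" for f :: "real \<Rightarrow> real"
    by (rule continuous_on_compose2[OF that]) (use q in \<open>auto intro!: continuous_intros\<close>)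
  have "K t j = regulator X t j" if j: "j \<in> I" for j
  proof (rule regulator_unique[where T="r - q" and L=K])
    show "continuous_on {0..} (\<lambda>t. X t j)" if "j \<in> I" for j
      unfolding X_def using shift[OF Bc[of j]] that D by (intro continuous_intros) auto
    show "continuous_on {0..r - q} (\<lambda>t. K t j)" if "j \<in> I" for j
      unfolding K_def using that D
      by (intro continuous_intros continuous_on_subset[OF shift[OF Lc[of j]]]) auto
    show "K 0 j = 0" for j by (simp add: K_def)
    show "mono_on {0..r - q} (\<lambda>t. K t j)" if "j \<in> I" for j
    proof (rule mono_onI)
      fix a b assume "a \<in> {0..r - q}" "b \<in> {0..r - q}" "a \<le> b"
      moreover have "j \<in> D" using that D by auto
      ultimately have "L (q + a) \<omega> j \<le> L (q + b) \<omega> j"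
        using q by (intro mono_onD[OF Lm]) auto
      then show "K a j \<le> K b j" by (simp add: K_def)
    qed
    show "0 \<le> X s j + (\<Sum>k\<in>I. R j k * K s k)" if "0 \<le> s" "s \<le> r - q" "j \<in> I" for s j
    proof -
      have "q + s \<le> r" "0 \<le> q + s" "j \<in> D" using that q D by auto
      then show ?thesis using XK[OF that(1) _ that(3)] Znn[of "q + s" j] by simp
    qed
    show "K a j = K b j" if "j \<in> I" "0 \<le> a" "a \<le> b" "b \<le> r - q"
      and less: "\<And>s. a \<le> s \<Longrightarrow> s \<le> b \<Longrightarrow> 0 < X s j + (\<Sum>k\<in>I. R j k * K s k)" for j a b
    proof -
      have "0 < Z s \<omega> j" if "q + a \<le> s" "s \<le> q + b" for s
      proof -
        have s: "a \<le> s - q" "s - q \<le> b" "0 \<le> s - q" "q + (s - q) \<le> r"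
          using that \<open>0 \<le> a\<close> \<open>b \<le> r - q\<close> by auto
        show ?thesis using less[OF s(1,2)] XK[OF s(3,4) \<open>j \<in> I\<close>] by simp
      qed
      then have "L (q + a) \<omega> j = L (q + b) \<omega> j"
        by (intro flat) (use \<open>j \<in> I\<close> \<open>0 \<le> a\<close> \<open>a \<le> b\<close> D q in auto)
      then show ?thesis by (simp add: K_def)
    qed
  qed (use t j in auto)
  then show ?thesis using XK[of t i] t i by simp
qed

end

section \<open>Countable covering of the hitting event\<close>

theorem theorem3p6:
  fixes d :: nat and \<mu> :: "nat \<Rightarrow> real" and A R :: "nat \<Rightarrow> nat \<Rightarrow> real" and J :: "nat set"
  assumes "d \<ge> 1"
    and "sym_pos_def_on {0..<d} A"
    and "reflection_nonsingular_M_matrix d R"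
    and "J \<noteq> {}" and "J \<subseteq> {0..<d}"
    and "\<And>I. J \<subseteq> I \<Longrightarrow> I \<subseteq> {0..<d} \<Longrightarrow> srbm_not_hit TYPE('w) I R \<mu> A I"
  shows "srbm_not_hit TYPE('w) {0..<d} R \<mu> A J"
  unfolding srbm_not_hit_def
proof (intro allI impI)
  fix z :: "nat \<Rightarrow> real" and M :: "'w measure" and F Z B L
  let ?D = "{0..<d}"
  assume "\<forall>i\<in>?D. 0 \<le> z i" and srbm: "srbm_on ?D R \<mu> A z M F Z B L"
  \<comment> \<open>The strict \<open>q < t\<close> makes the time \<open>t - q\<close> of the
    restarted process positive, since non-hitting says nothing about time 0: \<open>Z q\<close>
    itself may lie in the corner.\<close>
  define bad where "bad \<omega> I q r \<longleftrightarrow> (\<forall>i\<in>?D - I. \<forall>s\<in>{q..r}. 0 < Z s \<omega> i) \<and> (\<exists>t. q < t \<and> t \<le> r \<and> (\<forall>i\<in>I. Z t \<omega> i = 0))"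
    for \<omega> I q r
  have not_bad: "AE \<omega> in M. \<not> bad \<omega> I q r" if I: "J \<subseteq> I" "I \<subseteq> ?D" and q: "0 \<le> q" for I q r
  proof -
    obtain u \<theta> where "skorokhod_problem I R u \<theta>"
      using skorokhod_problem_subset[OF assms(3,1) I(2)] .
    then interpret skorokhod_problem I R u \<theta> .
    show ?thesis
      using restart_not_hit[OF srbm finite_atLeastLessThan I(2) q assms(6)[OF I]]
    proof (rule AE_mp, intro AE_I2 impI notI)
      fix \<omega> assume \<omega>: "\<omega> \<in> space M" and "bad \<omega> I q r"
        and no: "\<not> (\<exists>t>0. \<forall>i\<in>I. Z q \<omega> i + (B (q + t) \<omega> i - B q \<omega> i) +
          (\<Sum>j\<in>I. R i j * regulator (\<lambda>s i. Z q \<omega> i + (B (q + s) \<omega> i - B q \<omega> i)) t j) = 0)"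
      then obtain t where t: "q < t" "t \<le> r" "\<And>i. i \<in> I \<Longrightarrow> Z t \<omega> i = 0"
        and pos: "\<And>i s. i \<in> ?D - I \<Longrightarrow> q \<le> s \<Longrightarrow> s \<le> r \<Longrightarrow> 0 < Z s \<omega> i"
        by (auto simp: bad_def)
      have tq: "0 \<le> t - q" "q + (t - q) \<le> r" "0 < t - q" using t by auto
      have "Z q \<omega> i + (B (q + (t - q)) \<omega> i - B q \<omega> i) +
          (\<Sum>j\<in>I. R i j * regulator (\<lambda>s i. Z q \<omega> i + (B (q + s) \<omega> i - B q \<omega> i)) (t - q) j) = 0"
        if i: "i \<in> I" for i
      proof -
        have "Z q \<omega> i + (B (q + (t - q)) \<omega> i - B q \<omega> i) +
          (\<Sum>j\<in>I. R i j * regulator (\<lambda>s i. Z q \<omega> i + (B (q + s) \<omega> i - B q \<omega> i)) (t - q) j) = Z (q + (t - q)) \<omega> i"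
          by (rule reflected_path_eq[OF srbm finite_atLeastLessThan I(2) q \<omega> _ tq(1,2) i]) (rule pos)
        then show ?thesis using t(3)[OF i] by simp
      qed
      with no tq(3) show False by blast
    qed
  qed
  define C where "C = {I. J \<subseteq> I \<and> I \<subseteq> ?D} \<times> (\<rat> \<inter> {0::real..}) \<times> (\<rat> :: real set)"
  have "finite {I. J \<subseteq> I \<and> I \<subseteq> ?D}" by (rule finite_subset[of _ "Pow ?D"]) auto
  then have "countable C" unfolding C_def
    by (intro countable_SIGMA countable_finite countable_Int1 countable_rat)
  then have "AE \<omega> in M. \<forall>p\<in>C. \<not> (case p of (I, q, r) \<Rightarrow> bad \<omega> I q r)"
    by (subst AE_ball_countable) (use not_bad in \<open>auto simp: C_def\<close>)
  then show "AE \<omega> in M. \<forall>t>0. \<not> (\<forall>j\<in>J. Z t \<omega> j = 0)"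
  proof (rule AE_mp, intro AE_I2 impI allI notI)
    fix \<omega> and t :: real
    assume \<omega>: "\<omega> \<in> space M" and no: "\<forall>p\<in>C. \<not> (case p of (I, q, r) \<Rightarrow> bad \<omega> I q r)"
      and t: "0 < t" and hit: "\<forall>j\<in>J. Z t \<omega> j = 0"
    \<comment> \<open>It contains \<open>J\<close> because the edge is hit, and every other
      coordinate is strictly positive at \<open>t\<close>, hence nearby.\<close>
    define I where "I = {i \<in> ?D. Z t \<omega> i = 0}"
    have Zc: "continuous_on {0..} (\<lambda>s. Z s \<omega> i)" and Znn: "0 \<le> Z t \<omega> i" if "i \<in> ?D" for i
      using srbm \<omega> that t unfolding srbm_on_def continuous_paths_on_def by auto
    have "\<forall>\<^sub>F s in at t within {0..}. \<forall>i\<in>?D - I. 0 < Z s \<omega> i"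
    proof (rule eventually_ball_finite)
      show "\<forall>i\<in>?D - I. \<forall>\<^sub>F s in at t within {0..}. 0 < Z s \<omega> i"
      proof
        fix i assume i: "i \<in> ?D - I"
        have "0 < Z t \<omega> i" using i Znn[of i] by (auto simp: I_def)
        moreover have "((\<lambda>s. Z s \<omega> i) \<longlongrightarrow> Z t \<omega> i) (at t within {0..})"
          using Zc[of i] i t by (auto simp: continuous_on_def)
        ultimately show "\<forall>\<^sub>F s in at t within {0..}. 0 < Z s \<omega> i" by (rule order_tendstoD(1)[rotated])
      qed
    qed simp
    then obtain e where e: "0 < e" "\<And>s. s \<in> {0..} \<Longrightarrow> s \<noteq> t \<Longrightarrow> dist s t < e \<Longrightarrow> \<forall>i\<in>?D - I. 0 < Z s \<omega> i"
      unfolding eventually_at by blast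
    \<comment> \<open>The lower bound \<open>max 0 (t - e)\<close> keeps \<open>q\<close> both
      inside the neighbourhood of positivity and a legitimate restart time; \<open>t > 0\<close>
      leaves room for it.\<close>
    obtain q where q: "q \<in> \<rat>" "max 0 (t - e) < q" "q < t"
      using Rats_dense_in_real[of "max 0 (t - e)" t] t e by auto
    obtain r where r: "r \<in> \<rat>" "t < r" "r < t + e" using Rats_dense_in_real[of t "t + e"] e by auto
    have "0 < Z s \<omega> i" if "i \<in> ?D - I" "s \<in> {q..r}" for i s
    proof (cases "s = t")
      case True then show ?thesis using that(1) Znn[of i] by (auto simp: I_def)
    next
      case False
      have "dist s t < e" "s \<in> {0..}" using that q r by (auto simp: dist_real_def abs_less_iff)
      then show ?thesis using e(2)[of s] False that(1) by blast
    qed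
    then have "bad \<omega> I q r" using q r by (auto simp: bad_def I_def intro!: exI[of _ t])
    moreover have "(I, q, r) \<in> C" using hit assms(5) q r by (auto simp: C_def I_def)
    ultimately show False using no by auto
  qed
qed

end
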